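(* Let $K$ be a body in $\mathbb{R}^d$. For every packing $\mathcal{P}$ of $K$ there exists a uniformly recurrent packing $\mathcal{Q}$ of $K$ such that $\mathcal{Q}$ is a limit of $\mathcal{P}$. If $\mathcal{P}$ is uniformly dense, then so is $\mathcal{Q}$.
   Context: A domain is a subset of $\mathbb{R}^d$ that is the closure of its interior; a body is a compact domain. A packing of a body $K$ is a collection of congruent copies of $K$ in $\mathbb{R}^d$ (images under isometries) whose elements have pairwise disjoint interiors. Density: for a collection $\mathcal{P}$ of congruent copies of $K$, $$\delta(\mathcal{P})=\lim_{r\to\infty}\frac{\sum_{D\in\mathcal{P}}\mathrm{Vol}(B(p,r)\cap D)}{\mathrm{Vol}\,B(p,r)}$$ when the limit exists, where $p\in\mathbb{R}^d$ is any fixed point (existence and value do not depend on $p$) and $B(p,r)$ is the round ball of radius $r$ centered at $p$. $\mathcal{P}$ has uniform density if the convergence is uniform in $p$. The packing density $\delta(K)$ is the supremum of $\delta(\mathcal{P})$ over packings $\mathcal{P}$ of $K$. A packing is dense if $\delta(\mathcal{P})=\delta(K)$, and uniformly dense if it is dense and has uniform density. Topology: for collections of domains $\mathcal{P},\mathcal{Q}$, the modified Hausdorff distance satisfies $d(\mathcal{P},\mathcal{Q})\le\epsilon$ when there is a binary relation $A\sim B$ between elements $A\in\mathcal{P}$ and $B\in\mathcal{Q}$ such that $A\sim B$ implies that the Hausdorff distance between $A$ and $B$ is at most $\epsilon$; for each $A\in\mathcal{P}$ in the ball $B(0,1/\epsilon)$ there is a unique $B\in\mathcal{Q}$ with $A\sim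 B$; and for each $B\in\mathcal{Q}$ in $B(0,1/\epsilon)$ there is a unique $A\in\mathcal{P}$ with $A\sim B$. Convergence of packings is with respect to the induced (Hausdorff) topology. A packing $\mathcal{A}$ is a limit of a packing $\mathcal{B}$, written $\mathcal{A}\succeq_L\mathcal{B}$, if some sequence of translates of $\mathcal{B}$ converges to $\mathcal{A}$. The relation $\succeq_L$ is a reflexive and transitive relation on packings of $K$. A packing $\mathcal{A}$ is uniformly recurrent if it is maximal for this relation: whenever $\mathcal{B}\succeq_L\mathcal{A}$, also $\mathcal{A}\succeq_L\mathcal{B}$. *)

theory Defs
  imports "HOL-Analysis.Analysis"
begin

text \<open>
  The ambient space is an arbitrary Euclidean space, given by a type of class
  \<^class>\<open>euclidean_space\<close> (so its dimension is at least 1).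
\<close>

definition domain_set :: "'a::euclidean_space set \<Rightarrow> bool" where
  "domain_set S \<longleftrightarrow> S = closure (interior S)"

definition body :: "'a::euclidean_space set \<Rightarrow> bool" where
  "body K \<longleftrightarrow> compact K \<and> domain_set K"

definition isometry :: "('a::euclidean_space \<Rightarrow> 'a) \<Rightarrow> bool" where
  "isometry f \<longleftrightarrow> (\<forall>x y. dist (f x) (f y) = dist x y)"

text \<open>
  A copy of a nonempty body has nonempty interior, so disjointness of the interiors rules out
  repeated members; hence a collection of copies is taken to be a set of sets.
\<close>

definition packing :: "'a::euclidean_space set \<Rightarrow> 'a set set \<Rightarrow> bool" where
  "packing K P \<longleftrightarrow>
     (\<forall>D\<in>P. \<exists>f. isometry f \<and> D = f ` K) \<and>
     pairwise (\<lambda>D E. interior D \<inter> interior E = {}) P"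


subsection \<open>Density\<close>

text \<open>
  For a packing of a body only finitely many summands below are nonzero, so the default value 0
  of \<^const>\<open>infsum\<close> on non-summable families plays no role.
\<close>

definition ball_density :: "'a::euclidean_space set set \<Rightarrow> real \<Rightarrow> 'a \<Rightarrow> real" where
  "ball_density P r p =
     (\<Sum>\<^sub>\<infinity>D\<in>P. measure lebesgue (cball p r \<inter> D)) / measure lebesgue (cball p r)"

definition has_density :: "'a::euclidean_space set set \<Rightarrow> real \<Rightarrow> bool" where
  "has_density P \<delta> \<longleftrightarrow> (\<forall>p. ((\<lambda>r. ball_density P r p) \<longlongrightarrow> \<delta>) at_top)"

definition uniform_density :: "'a::euclidean_space set set \<Rightarrow> bool" where
  "uniform_density P \<longleftrightarrow> (\<exists>\<delta>. uniform_limit UNIV (ball_density P) (\<lambda>p. \<delta>) at_top)"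

text \<open>The supremum ranges over those packings whose density exists.\<close>

definition packing_density :: "'a::euclidean_space set \<Rightarrow> real" where
  "packing_density K = Sup {\<delta>. \<exists>P. packing K P \<and> has_density P \<delta>}"

definition dense_packing :: "'a::euclidean_space set \<Rightarrow> 'a set set \<Rightarrow> bool" where
  "dense_packing K P \<longleftrightarrow> packing K P \<and> has_density P (packing_density K)"

definition uniformly_dense :: "'a::euclidean_space set \<Rightarrow> 'a set set \<Rightarrow> bool" where
  "uniformly_dense K P \<longleftrightarrow> dense_packing K P \<and> uniform_density P"


subsection \<open>Convergence of packings\<close>

text \<open>
  Both distances are extended-valued, so that they are meaningful for empty or unbounded sets
  and for collections that are not related for any bound.
\<close>

definition hausdorff_distance :: "'a::metric_space set \<Rightarrow> 'a set \<Rightarrow> ennreal" where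
  "hausdorff_distance A B =
     max (SUP a\<in>A. INF b\<in>B. ennreal (dist a b)) (SUP b\<in>B. INF a\<in>A. ennreal (dist a b))"

definition collections_within ::
  "real \<Rightarrow> 'a::euclidean_space set set \<Rightarrow> 'a set set \<Rightarrow> bool" where
  "collections_within \<epsilon> P Q \<longleftrightarrow>
     (\<exists>R :: 'a set \<Rightarrow> 'a set \<Rightarrow> bool.
        (\<forall>A\<in>P. \<forall>B\<in>Q. R A B \<longrightarrow> hausdorff_distance A B \<le> ennreal \<epsilon>) \<and>
        (\<forall>A\<in>P. A \<subseteq> cball 0 (1 / \<epsilon>) \<longrightarrow> (\<exists>!B. B \<in> Q \<and> R A B)) \<and>
        (\<forall>B\<in>Q. B \<subseteq> cball 0 (1 / \<epsilon>) \<longrightarrow> (\<exists>!A. A \<in> P \<and> R A B)))"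

definition collection_distance ::
  "'a::euclidean_space set set \<Rightarrow> 'a set set \<Rightarrow> ennreal" where
  "collection_distance P Q = (INF \<epsilon>\<in>{\<epsilon>. 0 < \<epsilon> \<and> collections_within \<epsilon> P Q}. ennreal \<epsilon>)"

definition collections_converge ::
  "(nat \<Rightarrow> 'a::euclidean_space set set) \<Rightarrow> 'a set set \<Rightarrow> bool" where
  "collections_converge X A \<longleftrightarrow> (\<lambda>n. collection_distance (X n) A) \<longlonglongrightarrow> 0"

definition translate :: "'a::euclidean_space \<Rightarrow> 'a set set \<Rightarrow> 'a set set" where
  "translate t P = (\<lambda>D. (\<lambda>x. t + x) ` D) ` P"

definition is_limit_of :: "'a::euclidean_space set set \<Rightarrow> 'a set set \<Rightarrow> bool" where
  "is_limit_of A B \<longleftrightarrow> (\<exists>t :: nat \<Rightarrow> 'a. collections_converge (\<lambda>n. translate (t n) B) A)"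

definition uniformly_recurrent :: "'a::euclidean_space set \<Rightarrow> 'a set set \<Rightarrow> bool" where
  "uniformly_recurrent K A \<longleftrightarrow>
     packing K A \<and> (\<forall>B. packing K B \<and> is_limit_of B A \<longrightarrow> is_limit_of A B)"

end

theory Submission
  imports Defs "HOL-Library.Diagonal_Subsequence"
begin

text \<open>
  Packings of \<open>K\<close> form a sequentially compact space and \<open>\<succeq>\<^sub>L\<close> is transitive and closed. Call a
  packing recurrent up to \<open>e\<close> if, for any two of its limits, the first has a translate within \<open>e\<close>
  of the second. Every packing has such a limit, since otherwise one obtains an infinite sequence
  of packings that are pairwise far apart. Passing successively to limits recurrent up to
  \<open>1 / (n + 1)\<close> and then to an accumulation point gives the uniformly recurrent limit \<open>Q\<close>.
  For the density, the total volume of a packing inside a fixed ball is continuous in the packing,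
  and all translates of \<open>P\<close> approach its density at the same rate, so \<open>Q\<close> does as well.
\<close>

subsection \<open>Hausdorff closeness\<close>

text \<open>Maximality for \<open>is_limit_of\<close> needs only countably many steps because
  defects are graded by a tolerance: if \<open>B\<close> is a limit of \<open>Q\<close>, then
  \<open>B\<close> and \<open>Q\<close> are both limits of every stage of the construction, so the
  estimate attached to a stage compares them directly. The obstacle is the form of the distance
  between collections. It sees only the sets in a window of radius \<open>1 / e\<close> about the
  origin and demands unique partners there. So the triangle inequality is used for small tolerances,
  a translation costs window size, and compactness requires that distinct members of a packing stay
  a fixed distance apart. Such separation, the stability of interior points and the continuity of
  volumes fail for arbitrary compact sets that are Hausdorff close. For copies of one body they rest
  on the compactness of the isometries and on the invariance of volume. Separation also needs an
  interior point, so the empty body is treated apart.\<close>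

definition near :: "real \<Rightarrow> 'a::metric_space set \<Rightarrow> 'a set \<Rightarrow> bool" where
  "near e A B \<longleftrightarrow> (\<forall>a\<in>A. \<exists>b\<in>B. dist a b \<le> e) \<and> (\<forall>b\<in>B. \<exists>a\<in>A. dist a b \<le> e)"

lemma near_sym: "near e A B \<longleftrightarrow> near e B A"
  by (auto simp: near_def dist_commute)

lemma near_refl: "0 \<le> e \<Longrightarrow> near e A A"
  unfolding near_def by (metis dist_self)

lemma near_mono: "near d A B \<Longrightarrow> d \<le> e \<Longrightarrow> near e A B"
  unfolding near_def by (meson order_trans)

lemma near_trans:
  assumes "near d A B" "near e B C"
  shows "near (d + e) A C"
proof -
  have *: "\<exists>c\<in>C. dist a c \<le> d + e"
    if "\<forall>a\<in>A. \<exists>b\<in>B. dist a b \<le> d" "\<forall>b\<in>B. \<exists>c\<in>C. dist b c \<le> e" "a \<in> A"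
    for A B C :: "'a set" and a d e
    using that by (meson add_mono dist_triangle order_trans)
  show ?thesis
    using *[of A B d C e] *[of C B e A d] assms
    by (auto simp: near_def dist_commute add.commute)
qed

lemma near_image:
  assumes "\<And>x y. dist (f x) (f y) = dist x y"
  shows "near e (f ` A) (f ` B) \<longleftrightarrow> near e A B"
  using assms by (auto simp: near_def)

lemma near_subset_cball:
  fixes A B :: "'a::real_normed_vector set"
  assumes "near e A B" "A \<subseteq> cball 0 r"
  shows "B \<subseteq> cball 0 (r + e)"
proof
  fix b assume "b \<in> B"
  then obtain a where "a \<in> A" "dist a b \<le> e"
    using assms(1) by (auto simp: near_def)
  moreover have "dist 0 b \<le> dist 0 a + dist a b"
    by (rule dist_triangle)
  ultimately show "b \<in> cball 0 (r + e)"
    using assms(2) by fastforce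
qed

lemma near_all_imp_eq:
  assumes "closed A" "closed B" "\<And>e. 0 < e \<Longrightarrow> near e A B"
  shows "A = B"
proof -
  have *: "A \<subseteq> B" if "closed B" "\<And>e. 0 < e \<Longrightarrow> near e A B" for A B :: "'a set"
  proof
    fix x assume "x \<in> A"
    have "\<exists>y\<in>B. dist y x < e" if "0 < e" for e
    proof -
      have "near (e/2) A B"
        using \<open>\<And>e. 0 < e \<Longrightarrow> near e A B\<close> \<open>0 < e\<close> by simp
      then obtain y where "y \<in> B" "dist x y \<le> e/2"
        using \<open>x \<in> A\<close> by (auto simp: near_def)
      then show ?thesis
        using \<open>0 < e\<close> by (auto simp: dist_commute intro!: bexI[of _ y])
    qed
    then show "x \<in> B"
      using closed_approachable[OF \<open>closed B\<close>] by blast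
  qed
  show ?thesis
    using *[of B A] *[of A B] assms near_sym by blast
qed

text \<open>Compactness turns the infimum into a minimum, so the non-strict bound is attained by a
  point of \<open>B\<close>. For empty \<open>B\<close> the infimum is \<open>top\<close>, which no
  real bound reaches.\<close>

lemma Sup_Inf_dist_le_iff:
  assumes "compact B" "0 \<le> e"
  shows "(SUP a\<in>A. INF b\<in>B. ennreal (dist a b)) \<le> ennreal e \<longleftrightarrow> (\<forall>a\<in>A. \<exists>b\<in>B. dist a b \<le> e)"
proof -
  have "(INF b\<in>B. ennreal (dist a b)) \<le> ennreal e \<longleftrightarrow> (\<exists>b\<in>B. dist a b \<le> e)" for a
  proof
    assume le: "(INF b\<in>B. ennreal (dist a b)) \<le> ennreal e"
    show "\<exists>b\<in>B. dist a b \<le> e"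
    proof (cases "B = {}")
      case True
      then show ?thesis using le by (simp add: top_unique)
    next
      case False
      obtain b where b: "b \<in> B" "\<And>y. y \<in> B \<Longrightarrow> dist a b \<le> dist a y"
        using continuous_attains_inf[OF assms(1) False, of "dist a"]
          continuous_on_dist[OF continuous_on_const[of B a] continuous_on_id]
        by blast
      then have "ennreal (dist a b) \<le> (INF b\<in>B. ennreal (dist a b))"
        by (auto intro!: INF_greatest ennreal_leI)
      then have "ennreal (dist a b) \<le> ennreal e"
        using le by (rule order_trans)
      then show ?thesis
        using b(1) assms(2) by auto
    qed
  next
    assume "\<exists>b\<in>B. dist a b \<le> e"
    then show "(INF b\<in>B. ennreal (dist a b)) \<le> ennreal e"
      by (auto intro: INF_lower2 ennreal_leI)
  qed
  then show ?thesis
    by (simp add: SUP_le_iff)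
qed

lemma hausdorff_distance_le_iff:
  assumes "compact A" "compact B" "0 \<le> e"
  shows "hausdorff_distance A B \<le> ennreal e \<longleftrightarrow> near e A B"
  using Sup_Inf_dist_le_iff[OF assms(1,3), of B] Sup_Inf_dist_le_iff[OF assms(2,3), of A]
  by (simp add: hausdorff_distance_def near_def dist_commute)


subsection \<open>Isometries and congruent copies\<close>

lemma isometryD: "isometry f \<Longrightarrow> dist (f x) (f y) = dist x y"
  by (simp add: isometry_def)

lemma isometry_comp: "isometry f \<Longrightarrow> isometry g \<Longrightarrow> isometry (f \<circ> g)"
  by (simp add: isometry_def)

lemma isometry_translation: "isometry (\<lambda>x. t + x)"
  by (simp add: isometry_def)

lemma isometry_id: "isometry id"
  by (simp add: isometry_def)

lemma isometry_orthogonal_part: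
  assumes "isometry f"
  shows "orthogonal_transformation (\<lambda>x. f x - f 0)"
  using assms by (simp add: orthogonal_transformation_isometry isometry_def dist_norm)

text \<open>Surjectivity is not part of \<open>isometry\<close>; it comes from finite dimension,
  since the linear part is orthogonal and hence onto.\<close>

lemma isometry_bij:
  assumes "isometry f"
  shows "bij f"
proof (rule bijI)
  show "inj f"
    using assms unfolding isometry_def inj_def by (metis dist_eq_0_iff)
  show "surj f"
  proof (rule surjI)
    fix y
    have "surj (\<lambda>x. f x - f 0)"
      by (rule orthogonal_transformation_surj[OF isometry_orthogonal_part[OF assms]])
    then show "f (inv (\<lambda>x. f x - f 0) (y - f 0)) = y"
      by (metis (no_types, lifting) diff_eq_eq diff_add_cancel surj_f_inv_f)
  qed
qed

lemma isometry_inv: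
  assumes "isometry f"
  shows "isometry (inv f)"
proof -
  have "surj f"
    using isometry_bij[OF assms] by (rule bij_is_surj)
  then show ?thesis
    using assms unfolding isometry_def by (metis surj_f_inv_f)
qed

lemma isometry_continuous: "isometry f \<Longrightarrow> continuous_on S f"
  unfolding isometry_def continuous_on_iff by auto

lemma isometry_image_ball:
  assumes "isometry f"
  shows "f ` ball x r = ball (f x) r"
proof (intro subset_antisym subsetI)
  fix y assume "y \<in> ball (f x) r"
  moreover have "f (inv f y) = y"
    using isometry_bij[OF assms] by (simp add: bij_is_surj surj_f_inv_f)
  ultimately have "inv f y \<in> ball x r"
    using isometryD[OF assms, of x "inv f y"] by auto
  then show "y \<in> f ` ball x r"
    using \<open>f (inv f y) = y\<close> by force
qed (auto simp: isometryD[OF assms])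

lemma isometry_image_interior:
  assumes "isometry f"
  shows "interior (f ` S) = f ` interior S"
proof -
  have *: "f ` interior S \<subseteq> interior (f ` S)" if "isometry f" for f :: "'a \<Rightarrow> 'a" and S
  proof
    fix y assume "y \<in> f ` interior S"
    then obtain x r where x: "y = f x" "0 < r" "ball x r \<subseteq> S"
      by (auto simp: mem_interior)
    then have "ball y r \<subseteq> f ` S"
      using isometry_image_ball[OF that, of x r] image_mono[OF x(3), of f] by simp
    then show "y \<in> interior (f ` S)"
      using x(2) by (auto simp: mem_interior)
  qed
  have "inj f" "surj f"
    using isometry_bij[OF assms] by (auto simp: bij_is_inj bij_is_surj)
  \<comment> \<open>The reverse inclusion is the same fact for the inverse isometry, carried back by
    \<open>f\<close>.\<close>
  have "inv f ` interior (f ` S) \<subseteq> interior (inv f ` f ` S)"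
    by (rule *[OF isometry_inv[OF assms]])
  then have "f ` inv f ` interior (f ` S) \<subseteq> f ` interior S"
    using \<open>inj f\<close> by (simp add: image_inv_f_f image_mono)
  then show ?thesis
    using *[OF assms, of S] \<open>surj f\<close> by (simp add: image_f_inv_f)
qed

section \<open>Congruent copies: compactness, stable interiors, separation\<close>

definition copies :: "'a::euclidean_space set \<Rightarrow> 'a set set" where
  "copies K = {f ` K |f. isometry f}"

lemma copiesI: "isometry f \<Longrightarrow> f ` K \<in> copies K"
  by (auto simp: copies_def)

lemma packing_iff:
  "packing K P \<longleftrightarrow> P \<subseteq> copies K \<and> pairwise (\<lambda>D E. interior D \<inter> interior E = {}) P"
  unfolding packing_def copies_def by blast

lemma copies_image: "isometry f \<Longrightarrow> D \<in> copies K \<Longrightarrow> f ` D \<in> copies K"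
  unfolding copies_def mem_Collect_eq by (metis image_comp isometry_comp)

lemma compact_copies: "compact K \<Longrightarrow> D \<in> copies K \<Longrightarrow> compact D"
  by (auto simp: copies_def intro!: compact_continuous_image isometry_continuous)

lemma copies_subset_cball:
  assumes "compact K"
  obtains d where "0 < d" "\<And>D r. D \<in> copies K \<Longrightarrow> D \<inter> cball 0 r \<noteq> {} \<Longrightarrow> D \<subseteq> cball 0 (r + d)"
proof -
  obtain d' where d': "\<And>x y. x \<in> K \<Longrightarrow> y \<in> K \<Longrightarrow> dist x y \<le> d'"
    using compact_imp_bounded[OF assms] unfolding bounded_two_points by blast
  define d where "d = max d' 1"
  have d: "0 < d" "\<And>x y. x \<in> K \<Longrightarrow> y \<in> K \<Longrightarrow> dist x y \<le> d"
    using d' by (fastforce simp: d_def)+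
  have "D \<subseteq> cball 0 (r + d)" if "D \<in> copies K" "D \<inter> cball 0 r \<noteq> {}" for D r
  proof
    fix x assume "x \<in> D"
    obtain y where y: "y \<in> D" "norm y \<le> r"
      using \<open>D \<inter> cball 0 r \<noteq> {}\<close> by auto
    have "dist y x \<le> d"
      using \<open>D \<in> copies K\<close> \<open>x \<in> D\<close> y(1) d(2) by (auto simp: copies_def isometryD)
    then show "x \<in> cball 0 (r + d)"
      using dist_triangle[of 0 x y] y(2) by simp
  qed
  then show ?thesis
    using d(1) that by blast
qed

text \<open>An isometry is a translation after a linear map of norm at most one, so a sequence of
  isometries moving the origin boundedly lies in a compact set of such pairs.\<close>

lemma isometry_seq_compact:
  fixes f :: "nat \<Rightarrow> 'a::euclidean_space \<Rightarrow> 'a"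
  assumes "\<And>n. isometry (f n)" "bounded (range (\<lambda>n. f n 0))"
  obtains r g where "strict_mono r" "isometry g"
    "\<And>R e. 0 < e \<Longrightarrow> \<forall>\<^sub>F n in sequentially. \<forall>x\<in>cball 0 R. dist (f (r n) x) (g x) \<le> e"
proof -
  define L where "L n = Blinfun (\<lambda>x. f n x - f n 0)" for n
  have orth: "orthogonal_transformation (\<lambda>x. f n x - f n 0)" for n
    by (rule isometry_orthogonal_part[OF assms(1)])
  have L: "blinfun_apply (L n) x = f n x - f n 0" for n x
    unfolding L_def
    by (subst bounded_linear_Blinfun_apply)
       (simp_all add: linear_conv_bounded_linear[symmetric] orthogonal_transformation_linear[OF orth])
  have "norm (L n) \<le> 1" for n
    by (rule norm_blinfun_bound)
       (simp_all add: L orthogonal_transformation_norm[OF orth])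
  then have "bounded (range L)"
    by (auto simp: bounded_iff)
  then have "bounded (range (\<lambda>n. f n 0) \<times> range L)"
    using assms(2) by (rule bounded_Times[rotated])
  then have "bounded (range (\<lambda>n. (f n 0, L n)))"
    by (rule bounded_subset) auto
  then obtain l r where r: "strict_mono r" and lim: "((\<lambda>n. (f n 0, L n)) \<circ> r) \<longlonglongrightarrow> l"
    using bounded_imp_convergent_subsequence by blast
  define c M where "c = fst l" and "M = snd l"
  have c: "(\<lambda>n. f (r n) 0) \<longlonglongrightarrow> c"
    using tendsto_fst[OF lim] by (simp add: c_def o_def)
  have M: "(\<lambda>n. L (r n)) \<longlonglongrightarrow> M"
    using tendsto_snd[OF lim] by (simp add: M_def o_def)
  define g where "g x = c + blinfun_apply M x" for x
  have f_eq: "f n x = f n 0 + blinfun_apply (L n) x" for n x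
    by (simp add: L)
  have lim_g: "(\<lambda>n. f (r n) x) \<longlonglongrightarrow> g x" for x
    unfolding g_def by (subst f_eq) (intro tendsto_intros c M)
  have "isometry g"
    unfolding isometry_def
  proof (intro allI)
    fix x y
    have "(\<lambda>n. dist (f (r n) x) (f (r n) y)) \<longlonglongrightarrow> dist (g x) (g y)"
      by (intro tendsto_intros lim_g)
    then show "dist (g x) (g y) = dist x y"
      by (simp add: isometryD[OF assms(1)] LIMSEQ_const_iff)
  qed
  moreover have "\<forall>\<^sub>F n in sequentially. \<forall>x\<in>cball 0 R. dist (f (r n) x) (g x) \<le> e" if "0 < e" for R e
  proof -
    have "(\<lambda>n. norm (f (r n) 0 - c) + norm (L (r n) - M) * \<bar>R\<bar>) \<longlonglongrightarrow> norm (c - c) + norm (M - M) * \<bar>R\<bar>"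
      by (intro tendsto_intros c M)
    then have "\<forall>\<^sub>F n in sequentially. norm (f (r n) 0 - c) + norm (L (r n) - M) * \<bar>R\<bar> < e"
      using \<open>0 < e\<close> by (intro order_tendstoD) auto
    then show ?thesis
    proof eventually_elim
      case (elim n)
      show ?case
      proof
        fix x :: 'a assume x: "x \<in> cball 0 R"
        have "dist (f (r n) x) (g x) = norm ((f (r n) 0 - c) + blinfun_apply (L (r n) - M) x)"
          unfolding g_def dist_norm by (subst f_eq) (simp add: blinfun.diff_left algebra_simps)
        also have "\<dots> \<le> norm (f (r n) 0 - c) + norm (L (r n) - M) * norm x"
          by (intro norm_triangle_le add_left_mono norm_blinfun)
        also have "\<dots> \<le> norm (f (r n) 0 - c) + norm (L (r n) - M) * \<bar>R\<bar>"
          using x by (intro add_left_mono mult_left_mono) auto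
        finally show "dist (f (r n) x) (g x) \<le> e"
          using elim by simp
      qed
    qed
  qed
  ultimately show ?thesis
    using r that by blast
qed

text \<open>Copies that meet a fixed ball have bounded images of the origin, so a subsequence of the
  isometries converges uniformly on a ball containing \<open>K\<close>. Pointwise convergence of the
  maps is recorded as well, because the image sets alone do not reveal what happens to interior
  points.\<close>

lemma isometry_seq_compact_image:
  fixes f :: "nat \<Rightarrow> 'a::euclidean_space \<Rightarrow> 'a"
  assumes "compact K" "K \<noteq> {}" "\<And>n. isometry (f n)" "\<And>n. f n ` K \<inter> cball 0 R \<noteq> {}"
  obtains r g where "strict_mono r" "isometry g"
    "\<forall>e>0. \<forall>\<^sub>F n in sequentially. near e (f (r n) ` K) (g ` K)"
    "\<forall>x. (\<lambda>n. f (r n) x) \<longlonglongrightarrow> g x"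
proof -
  obtain B where B: "\<And>x. x \<in> K \<Longrightarrow> norm x \<le> B"
    using compact_imp_bounded[OF assms(1)] by (auto simp: bounded_iff)
  have "norm (f n 0) \<le> R + B" for n
  proof -
    obtain x where x: "x \<in> K" "norm (f n x) \<le> R"
      using assms(4)[of n] by auto
    then have "dist (f n x) (f n 0) \<le> B"
      using B[of x] by (simp add: isometryD[OF assms(3)])
    then show ?thesis
      using x(2) dist_triangle[of "f n 0" 0 "f n x"] by (simp add: dist_commute)
  qed
  then have "bounded (range (\<lambda>n. f n 0))"
    by (auto simp: bounded_iff)
  from isometry_seq_compact[OF assms(3) this] obtain r g where r: "strict_mono r" "isometry g"
    and lim: "\<And>R e. 0 < e \<Longrightarrow> \<forall>\<^sub>F n in sequentially. \<forall>x\<in>cball 0 R. dist (f (r n) x) (g x) \<le> e"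
    by blast
  have "\<forall>\<^sub>F n in sequentially. near e (f (r n) ` K) (g ` K)" if "0 < e" for e
    using lim[OF that, of B]
  proof eventually_elim
    case (elim n)
    then show ?case
      using B by (fastforce simp: near_def)
  qed
  moreover have "(\<lambda>n. f (r n) x) \<longlonglongrightarrow> g x" for x
  proof (rule tendstoI)
    fix e :: real assume "0 < e"
    then have "\<forall>\<^sub>F n in sequentially. \<forall>y\<in>cball 0 (norm x). dist (f (r n) y) (g y) \<le> e/2"
      by (intro lim) auto
    then show "\<forall>\<^sub>F n in sequentially. dist (f (r n) x) (g x) < e"
    proof eventually_elim
      case (elim n)
      then have "dist (f (r n) x) (g x) \<le> e/2"
        by simp
      then show ?case
        using \<open>0 < e\<close> by linarith
    qed
  qed
  ultimately show ?thesis
    using r that by blast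
qed

lemma copies_seq_compact:
  fixes D :: "nat \<Rightarrow> 'a::euclidean_space set"
  assumes "compact K" "\<And>n. D n \<in> copies K" "\<And>n. D n \<inter> cball 0 R \<noteq> {}"
  obtains r E where "strict_mono r" "E \<in> copies K"
    "\<And>e. 0 < e \<Longrightarrow> \<forall>\<^sub>F n in sequentially. near e (D (r n)) E"
proof -
  have "\<exists>f. isometry f \<and> D n = f ` K" for n
    using assms(2)[of n] by (auto simp: copies_def)
  then obtain f where f: "\<And>n. isometry (f n)" "\<And>n. D n = f n ` K"
    by metis
  moreover have "K \<noteq> {}"
    using assms(3) f by fastforce
  ultimately obtain r g where "strict_mono r" "isometry g"
    "\<forall>e>0. \<forall>\<^sub>F n in sequentially. near e (f (r n) ` K) (g ` K)"
    using isometry_seq_compact_image[OF assms(1), of f R] assms(3) by metis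
  then show ?thesis
    using that[of r "g ` K"] f(2) by (simp add: copiesI)
qed

text \<open>A fine finite net of \<open>D\<close> is Hausdorff close to \<open>D\<close> without
  having interior points, so congruence is essential. Counterexamples ever closer to
  \<open>D\<close> would be images of \<open>K\<close> under isometries that converge to some
  \<open>g\<close> with image \<open>D\<close>; a ball in \<open>K\<close> around the preimage of
  \<open>x\<close> under \<open>g\<close> is then carried by late isometries to balls that contain
  \<open>x\<close>.\<close>

lemma interior_stable:
  assumes "compact K" "D \<in> copies K" "x \<in> interior D"
  shows "\<exists>e>0. \<forall>D'\<in>copies K. near e D' D \<longrightarrow> x \<in> interior D'"
proof (rule ccontr)
  assume "\<not> ?thesis"
  then have "\<exists>D'\<in>copies K. near (1 / Suc n) D' D \<and> x \<notin> interior D'" for n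
    by (metis of_nat_0_less_iff zero_less_Suc zero_less_divide_1_iff)
  then obtain D' where D': "\<And>n. D' n \<in> copies K" "\<And>n. near (1 / Suc n) (D' n) D"
    "\<And>n. x \<notin> interior (D' n)"
    by metis
  have "\<exists>f. isometry f \<and> D' n = f ` K" for n
    using D'(1)[of n] by (auto simp: copies_def)
  then obtain f where f: "\<And>n. isometry (f n)" "\<And>n. D' n = f n ` K"
    by metis
  have xD: "x \<in> D"
    using assms(3) interior_subset by blast
  have meets: "f n ` K \<inter> cball 0 (norm x + 1) \<noteq> {}" for n
  proof -
    obtain y where y: "y \<in> D' n" "dist y x \<le> 1 / Suc n"
      using D'(2)[of n] xD by (auto simp: near_def)
    have "1 / real (Suc n) \<le> 1"
      by simp
    then have "dist y x \<le> 1"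
      using y(2) by linarith
    then have "y \<in> cball 0 (norm x + 1)"
      using dist_triangle[of y 0 x] by simp
    then show ?thesis
      using y(1) f(2)[of n] by blast
  qed
  then have "K \<noteq> {}"
    by fastforce
  obtain r g where
    r: "strict_mono r" and g: "isometry g"
    and near_g: "\<forall>e>0. \<forall>\<^sub>F n in sequentially. near e (f (r n) ` K) (g ` K)"
    and lim_g: "\<forall>x. (\<lambda>n. f (r n) x) \<longlonglongrightarrow> g x"
    by (rule isometry_seq_compact_image[where f = f, OF assms(1) \<open>K \<noteq> {}\<close> f(1) meets])
  have "near e D (g ` K)" if "0 < e" for e
  proof -
    have "(\<lambda>n. 1 / real (Suc (r n))) \<longlonglongrightarrow> 0"
      using LIMSEQ_subseq_LIMSEQ[OF LIMSEQ_Suc[OF lim_1_over_n] r] by (simp add: o_def)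
    then have "\<forall>\<^sub>F n in sequentially. 1 / real (Suc (r n)) < e/2"
      using that by (intro order_tendstoD) auto
    moreover have "\<forall>\<^sub>F n in sequentially. near (e/2) (f (r n) ` K) (g ` K)"
      using near_g that by simp
    ultimately have "\<forall>\<^sub>F n in sequentially. near e D (g ` K)"
    proof eventually_elim
      case (elim n)
      have "near (e/2) D (f (r n) ` K)"
        using D'(2)[of "r n"] elim(1) f(2) by (metis less_imp_le near_mono near_sym)
      from near_trans[OF this elim(2)] show ?case by simp
    qed
    then show ?thesis by simp
  qed
  then have "D = g ` K"
    using compact_copies[OF assms(1)] assms(2) copiesI[OF g]
    by (intro near_all_imp_eq) (auto intro: compact_imp_closed)
  then obtain y where y: "x = g y" "y \<in> interior K"
    using assms(3) isometry_image_interior[OF g, of K] by auto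
  then obtain \<rho> where \<rho>: "0 < \<rho>" "ball y \<rho> \<subseteq> K"
    by (auto simp: mem_interior)
  have "\<forall>\<^sub>F n in sequentially. dist (f (r n) y) (g y) < \<rho>"
    using lim_g[rule_format, of y] \<rho>(1) by (rule tendstoD)
  then obtain n where n: "dist (f (r n) y) (g y) < \<rho>"
    by (auto dest: eventually_happens)
  then have "x \<in> f (r n) ` ball y \<rho>"
    using y(1) by (simp add: isometry_image_ball[OF f(1)])
  also have "f (r n) ` ball y \<rho> \<subseteq> interior (D' (r n))"
    using image_mono[OF \<rho>(2), of "f (r n)"] unfolding f(2)
    by (intro interior_maximal) (simp_all add: isometry_image_ball[OF f(1)])
  finally show False
    using D'(3) by blast
qed

text \<open>One interior point of \<open>K\<close> yields a threshold for the copies close to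
  \<open>K\<close> itself. Since \<open>near\<close> is invariant under isometries, pulling a pair
  back by the isometry that produces \<open>E\<close> makes this threshold valid for all
  pairs.\<close>

lemma copies_separated:
  assumes "compact K" "interior K \<noteq> {}"
  shows "\<exists>e>0. \<forall>D\<in>copies K. \<forall>E\<in>copies K. near e D E \<longrightarrow> interior D \<inter> interior E \<noteq> {}"
proof -
  obtain x where x: "x \<in> interior K"
    using assms(2) by blast
  have "K \<in> copies K"
    using copiesI[OF isometry_id, of K] by simp
  from interior_stable[OF assms(1) this x] obtain e where e: "0 < e"
    "\<And>D. D \<in> copies K \<Longrightarrow> near e D K \<Longrightarrow> x \<in> interior D"
    by blast
  have "interior D \<inter> interior E \<noteq> {}" if DE: "D \<in> copies K" "E \<in> copies K" "near e D E" for D E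
  proof -
    obtain f where f: "isometry f" "E = f ` K"
      using DE(2) by (auto simp: copies_def)
    have fi: "f ` inv f ` D = D"
      using isometry_bij[OF f(1)] by (simp add: bij_is_surj image_f_inv_f)
    then have "near e (inv f ` D) K"
      using near_image[of f e "inv f ` D" K] DE(3) f by (simp add: isometryD)
    then have "x \<in> interior (inv f ` D)"
      using e(2) DE(1) copies_image isometry_inv[OF f(1)] by blast
    then have "f x \<in> interior D"
      using isometry_image_interior[OF f(1), of "inv f ` D"] fi by auto
    moreover have "f x \<in> interior E"
      using isometry_image_interior[OF f(1), of K] f(2) x by auto
    ultimately show ?thesis by blast
  qed
  then show ?thesis
    using e(1) by blast
qed

lemma packing_eqI:
  assumes "packing K P" "D \<in> P" "E \<in> P" "interior D \<inter> interior E \<noteq> {}"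
  shows "D = E"
  using assms unfolding packing_def pairwise_def by blast

text \<open>Infinitely many members would accumulate at some copy; two of them would then be close
  enough to share an interior point, which forces them to coincide.\<close>

lemma packing_locally_finite:
  assumes "compact K" "interior K \<noteq> {}" "packing K P"
  shows "finite {D \<in> P. D \<inter> cball 0 R \<noteq> {}}" (is "finite ?S")
proof (rule ccontr)
  assume "infinite ?S"
  then obtain D :: "nat \<Rightarrow> 'a set" where D: "inj D" "range D \<subseteq> ?S"
    using infinite_countable_subset by blast
  obtain e where e: "0 < e"
    "\<And>D E. D \<in> copies K \<Longrightarrow> E \<in> copies K \<Longrightarrow> near e D E \<Longrightarrow> interior D \<inter> interior E \<noteq> {}"
    using copies_separated[OF assms(1,2)] by blast
  have DP: "D n \<in> P" "D n \<in> copies K" "D n \<inter> cball 0 R \<noteq> {}" for n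
    using D(2) assms(3) by (auto simp: packing_iff)
  obtain r E where r: "strict_mono r" "E \<in> copies K"
    "\<And>e. 0 < e \<Longrightarrow> \<forall>\<^sub>F n in sequentially. near e (D (r n)) E"
    using copies_seq_compact[OF assms(1), of D R] DP(2,3) by metis
  obtain N where N: "\<And>n. N \<le> n \<Longrightarrow> near (e/2) (D (r n)) E"
    using r(3)[of "e/2"] e(1) by (auto simp: eventually_sequentially)
  have "near (e/2 + e/2) (D (r N)) (D (r (Suc N)))"
    using N[of N] N[of "Suc N"] near_sym near_trans by (metis le_SucI order_refl)
  then have "D (r N) = D (r (Suc N))"
    using e(2) DP packing_eqI[OF assms(3)] by (metis field_sum_of_halves)
  then show False
    using D(1) r(1) by (metis injD lessI less_irrefl strict_monoD)
qed


subsection \<open>Convergence of families of compact sets\<close>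

text \<open>Confining the relation to \<open>P\<close> and \<open>Q\<close> makes uniqueness a
  statement about \<open>R\<close> alone, so that such relations can be inverted and composed. Sets
  that leave the window may have no partner or several.\<close>

definition matching ::
  "real \<Rightarrow> 'a::euclidean_space set set \<Rightarrow> 'a set set \<Rightarrow> ('a set \<Rightarrow> 'a set \<Rightarrow> bool) \<Rightarrow> bool" where
  "matching e P Q R \<longleftrightarrow>
     (\<forall>A B. R A B \<longrightarrow> A \<in> P \<and> B \<in> Q \<and> near e A B) \<and>
     (\<forall>A\<in>P. A \<subseteq> cball 0 (1 / e) \<longrightarrow> (\<exists>!B. R A B)) \<and>
     (\<forall>B\<in>Q. B \<subseteq> cball 0 (1 / e) \<longrightarrow> (\<exists>!A. R A B))"

definition matched :: "real \<Rightarrow> 'a::euclidean_space set set \<Rightarrow> 'a set set \<Rightarrow> bool" where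
  "matched e P Q \<longleftrightarrow> (\<exists>R. matching e P Q R)"

lemma matchingD:
  assumes "matching e P Q R"
  shows "R A B \<Longrightarrow> A \<in> P \<and> B \<in> Q \<and> near e A B"
    and "A \<in> P \<Longrightarrow> A \<subseteq> cball 0 (1 / e) \<Longrightarrow> \<exists>!B. R A B"
    and "B \<in> Q \<Longrightarrow> B \<subseteq> cball 0 (1 / e) \<Longrightarrow> \<exists>!A. R A B"
  using assms unfolding matching_def by simp_all

lemma matchedI:
  assumes "\<And>A B. R A B \<Longrightarrow> A \<in> P \<and> B \<in> Q \<and> near e A B"
    and "\<And>A. A \<in> P \<Longrightarrow> A \<subseteq> cball 0 (1 / e) \<Longrightarrow> \<exists>!B. R A B"
    and "\<And>B. B \<in> Q \<Longrightarrow> B \<subseteq> cball 0 (1 / e) \<Longrightarrow> \<exists>!A. R A B"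
  shows "matched e P Q"
  unfolding matched_def matching_def using assms by (intro exI[of _ R]) simp

lemma collections_within_iff:
  assumes "\<And>A. A \<in> P \<Longrightarrow> compact A" "\<And>B. B \<in> Q \<Longrightarrow> compact B" "0 \<le> e"
  shows "collections_within e P Q \<longleftrightarrow> matched e P Q"
proof
  assume "collections_within e P Q"
  then obtain R where R: "\<forall>A\<in>P. \<forall>B\<in>Q. R A B \<longrightarrow> hausdorff_distance A B \<le> ennreal e"
    "\<forall>A\<in>P. A \<subseteq> cball 0 (1 / e) \<longrightarrow> (\<exists>!B. B \<in> Q \<and> R A B)"
    "\<forall>B\<in>Q. B \<subseteq> cball 0 (1 / e) \<longrightarrow> (\<exists>!A. A \<in> P \<and> R A B)"
    unfolding collections_within_def by (elim exE conjE) (rule that)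
  note R = R[rule_format]
  have "near e A B" if "A \<in> P" "B \<in> Q" "R A B" for A B
    using R(1)[OF that] that assms by (simp add: hausdorff_distance_le_iff)
  moreover have "\<exists>!B. A \<in> P \<and> B \<in> Q \<and> R A B" if "A \<in> P" "A \<subseteq> cball 0 (1 / e)" for A
    using R(2)[OF that] that(1) by simp
  moreover have "\<exists>!A. A \<in> P \<and> B \<in> Q \<and> R A B" if "B \<in> Q" "B \<subseteq> cball 0 (1 / e)" for B
    using R(3)[OF that] that(1) by simp
  ultimately show "matched e P Q"
    by (rule_tac matchedI[where R = "\<lambda>A B. A \<in> P \<and> B \<in> Q \<and> R A B"]) simp_all
next
  assume "matched e P Q"
  then obtain R where "matching e P Q R"
    unfolding matched_def by blast
  note R = matchingD[OF this]
  have dist_le: "hausdorff_distance A B \<le> ennreal e" if "R A B" for A B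
    using R(1)[OF that] assms by (simp add: hausdorff_distance_le_iff)
  have iff: "B \<in> Q \<and> R A B \<longleftrightarrow> R A B" "A \<in> P \<and> R A B \<longleftrightarrow> R A B" for A B
    using R(1) by blast+
  show "collections_within e P Q"
    unfolding collections_within_def
    by (intro exI[of _ R] conjI ballI impI; (unfold iff)?) (rule dist_le R(2,3); assumption)+
qed

lemma matched_sym:
  assumes "matched e P Q"
  shows "matched e Q P"
proof -
  obtain R where "matching e P Q R"
    using assms unfolding matched_def by blast
  note R = matchingD[OF this]
  show ?thesis
  proof (rule matchedI[where R = "\<lambda>A B. R B A"])
    show "A \<in> Q \<and> B \<in> P \<and> near e A B" if "R B A" for A B
      using R(1)[OF that] near_sym by blast
  qed (fact R)+
qed

lemma matched_refl: "0 \<le> e \<Longrightarrow> matched e P P"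
  by (rule matchedI[where R = "\<lambda>A B. A \<in> P \<and> A = B"]) (auto simp: near_refl)

lemma matched_mono:
  assumes "matched d P Q" "0 < d" "d \<le> e"
  shows "matched e P Q"
proof -
  have "1 / e \<le> 1 / d"
    using assms by (simp add: frac_le)
  then have sub: "A \<subseteq> cball 0 (1 / e) \<Longrightarrow> A \<subseteq> cball 0 (1 / d)" for A :: "'a set"
    by (meson order_trans subset_cball)
  obtain R where "matching d P Q R"
    using assms(1) unfolding matched_def by blast
  note R = matchingD[OF this]
  show ?thesis
  proof (rule matchedI[where R = R])
    show "A \<in> P \<and> B \<in> Q \<and> near e A B" if "R A B" for A B
      using R(1)[OF that] near_mono[OF _ assms(3)] by blast
  qed (use R(2,3) sub in simp_all)
qed

text \<open>The two relations are composed. Doubling \<open>e\<close> covers the sum of the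
  displacements and also shrinks the window: the partner of a set within radius
  \<open>1 / (2 * e)\<close> lies within \<open>1 / (2 * e) + e\<close>, which is at most
  \<open>1 / e\<close> because \<open>e * e\<close> is at most 1/4, and there the second relation
  still has unique partners.\<close>

lemma matched_trans:
  assumes "matched e P Q" "matched e Q S" "0 < e" "e \<le> 1/2"
  shows "matched (2 * e) P S"
proof -
  have "e * e \<le> 1/2 * (1/2)"
    using assms(3,4) by (intro mult_mono) auto
  then have "1 / (2 * e) + e \<le> 1 / e"
    using assms(3) by (simp add: field_simps)
  then have sub: "B \<subseteq> cball 0 (1 / e)" if "near e A B" "A \<subseteq> cball 0 (1 / (2 * e))" for A B :: "'a set"
    using near_subset_cball[OF that] by (meson order_trans subset_cball)
  have "1 / (2 * e) \<le> 1 / e"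
    using assms(3) by (simp add: field_simps)
  then have sub': "A \<subseteq> cball 0 (1 / e)" if "A \<subseteq> cball 0 (1 / (2 * e))" for A :: "'a set"
    using that by (meson order_trans subset_cball)
  \<comment> \<open>Stated for arbitrary relations, since it is applied a second time to the
    converse relations, from \<open>S\<close> back to \<open>P\<close>.\<close>
  have comp: "\<exists>!C. \<exists>B. R A B \<and> R' B C"
    if R: "\<And>A B. R A B \<Longrightarrow> A \<in> P \<and> B \<in> Q \<and> near e A B"
      "\<And>A. A \<in> P \<Longrightarrow> A \<subseteq> cball 0 (1 / e) \<Longrightarrow> \<exists>!B. R A B"
      and R': "\<And>B. B \<in> Q \<Longrightarrow> B \<subseteq> cball 0 (1 / e) \<Longrightarrow> \<exists>!C. R' B C"
      and A: "A \<in> P" "A \<subseteq> cball 0 (1 / (2 * e))"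
    for P Q and R R' :: "'a set \<Rightarrow> 'a set \<Rightarrow> bool" and A
  proof -
    obtain B where B: "R A B" "\<And>B'. R A B' \<Longrightarrow> B' = B"
      using R(2)[OF A(1) sub'[OF A(2)]] by blast
    have "B \<in> Q" "B \<subseteq> cball 0 (1 / e)"
      using R(1)[OF B(1)] sub A(2) by blast+
    from R'[OF this] show ?thesis
      using B by metis
  qed
  obtain R where "matching e P Q R"
    using assms(1) unfolding matched_def by blast
  note R = matchingD[OF this]
  obtain R' where "matching e Q S R'"
    using assms(2) unfolding matched_def by blast
  note R' = matchingD[OF this]
  have "A \<in> P \<and> C \<in> S \<and> near (2 * e) A C" if "R A B" "R' B C" for A B C
    using R(1)[OF that(1)] R'(1)[OF that(2)] near_trans[of e A B e C] by simp
  moreover have "\<exists>!C. \<exists>B. R A B \<and> R' B C" if "A \<in> P" "A \<subseteq> cball 0 (1 / (2 * e))" for A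
    by (rule comp[where P = P and Q = Q]) (fact R R' that)+
  moreover have "\<exists>!A. \<exists>B. R' B C \<and> R A B" if "C \<in> S" "C \<subseteq> cball 0 (1 / (2 * e))" for C
  proof (rule comp[where P = S and Q = Q and R = "\<lambda>C B. R' B C" and R' = "\<lambda>B A. R A B"])
    show "A \<in> S \<and> B \<in> Q \<and> near e A B" if "R' B A" for A B
      using R'(1)[OF that] near_sym by blast
  qed (fact R R' that)+
  ultimately show ?thesis
    by (intro matchedI[where R = "\<lambda>A C. \<exists>B. R A B \<and> R' B C"]) (auto simp: conj_commute)
qed

lemma translate_translate: "translate s (translate t P) = translate (s + t) P"
  by (simp add: translate_def image_image add.assoc)

lemma translate_0: "translate 0 P = P"
  by (simp add: translate_def)

text \<open>The window is centred at the origin, so closeness is not translation invariant: a set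
  inside radius \<open>1 / e\<close> after the shift by \<open>t\<close> is only known to lie inside
  radius \<open>1 / e + norm t\<close> before it.\<close>

lemma matched_translate:
  assumes "matched d P Q" "0 < d" "d \<le> e" "1 / e + norm t \<le> 1 / d"
  shows "matched e (translate t P) (translate t Q)"
proof -
  have sub: "A \<subseteq> cball 0 (1 / d)" if "(+) t ` A \<subseteq> cball 0 (1 / e)" for A
  proof
    fix x assume "x \<in> A"
    then have "norm (t + x) \<le> 1 / e"
      using that by auto
    then show "x \<in> cball 0 (1 / d)"
      using norm_triangle_ineq4[of "t + x" t] assms(4) by simp
  qed
  have inj: "(+) t ` A = (+) t ` B \<longleftrightarrow> A = B" for A B
    by (simp add: inj_image_eq_iff)
  obtain R where "matching d P Q R"
    using assms(1) unfolding matched_def by blast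
  note R = matchingD[OF this]
  define R' where "R' A B \<longleftrightarrow> (\<exists>A' B'. R A' B' \<and> A = (+) t ` A' \<and> B = (+) t ` B')" for A B
  have "A \<in> translate t P \<and> B \<in> translate t Q \<and> near e A B" if R'AB: "R' A B" for A B
  proof -
    obtain A' B' where "R A' B'" "A = (+) t ` A'" "B = (+) t ` B'"
      using R'AB unfolding R'_def by blast
    moreover have "near e A B"
      using near_mono[OF _ assms(3), of A' B'] R(1)[of A' B'] calculation by (simp add: near_image)
    ultimately show ?thesis
      using R(1)[of A' B'] by (simp add: translate_def)
  qed
  moreover have "\<exists>!B. R' A B" if A: "A \<in> translate t P" "A \<subseteq> cball 0 (1 / e)" for A
  proof -
    obtain A' where A': "A = (+) t ` A'" "A' \<in> P"
      using A(1) by (auto simp: translate_def)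
    have "A' \<subseteq> cball 0 (1 / d)"
      using sub[of A'] A(2) A'(1) by simp
    from R(2)[OF A'(2) this] obtain B' where B': "R A' B'" "\<forall>B. R A' B \<longrightarrow> B = B'"
      by (elim ex1E) (rule that)
    show ?thesis
    proof (rule ex1I)
      show "R' A ((+) t ` B')"
        using A'(1) B'(1) unfolding R'_def by blast
      show "B = (+) t ` B'" if "R' A B" for B
        using that A'(1) B'(2) unfolding R'_def by (metis inj)
    qed
  qed
  moreover have "\<exists>!A. R' A B" if B: "B \<in> translate t Q" "B \<subseteq> cball 0 (1 / e)" for B
  proof -
    obtain B' where B': "B = (+) t ` B'" "B' \<in> Q"
      using B(1) by (auto simp: translate_def)
    have "B' \<subseteq> cball 0 (1 / d)"
      using sub[of B'] B(2) B'(1) by simp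
    from R(3)[OF B'(2) this] obtain A' where A': "R A' B'" "\<forall>A. R A B' \<longrightarrow> A = A'"
      by (elim ex1E) (rule that)
    show ?thesis
    proof (rule ex1I)
      show "R' ((+) t ` A') B"
        using B'(1) A'(1) unfolding R'_def by blast
      show "A = (+) t ` A'" if "R' A B" for A
        using that B'(1) A'(2) unfolding R'_def by (metis inj)
    qed
  qed
  ultimately show ?thesis
    by (rule matchedI)
qed

text \<open>Admissible tolerances are upward closed, so an infimum below \<open>e\<close> makes
  \<open>e\<close> itself admissible; compactness of the members lets \<open>near\<close> replace
  the Hausdorff distance.\<close>

lemma collections_converge_iff:
  assumes "\<And>n A. A \<in> X n \<Longrightarrow> compact A" "\<And>B. B \<in> Q \<Longrightarrow> compact B"
  shows "collections_converge X Q \<longleftrightarrow> (\<forall>e>0. \<forall>\<^sub>F n in sequentially. matched e (X n) Q)"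
proof
  assume conv: "collections_converge X Q"
  show "\<forall>e>0. \<forall>\<^sub>F n in sequentially. matched e (X n) Q"
  proof (intro allI impI)
    fix e :: real assume "0 < e"
    then have "\<forall>\<^sub>F n in sequentially. collection_distance (X n) Q < ennreal e"
      using conv unfolding collections_converge_def by (intro order_tendstoD) auto
    then show "\<forall>\<^sub>F n in sequentially. matched e (X n) Q"
    proof eventually_elim
      case (elim n)
      then obtain d where "0 < d" "collections_within d (X n) Q" "ennreal d < ennreal e"
        unfolding collection_distance_def INF_less_iff by blast
      then show ?case
        using matched_mono[of d "X n" Q e] collections_within_iff[of "X n" Q d] assms
        by (simp add: ennreal_less_iff)
    qed
  qed
next
  assume ev: "\<forall>e>0. \<forall>\<^sub>F n in sequentially. matched e (X n) Q"
  show "collections_converge X Q"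
    unfolding collections_converge_def
  proof (rule order_tendstoI)
    fix a :: ennreal assume "0 < a"
    then obtain b where b: "0 < b" "b < a"
      using dense by blast
    then obtain e where e: "b = ennreal e" "0 < e"
      by (cases b) auto
    have "\<forall>\<^sub>F n in sequentially. matched e (X n) Q"
      using ev e(2) by blast
    then show "\<forall>\<^sub>F n in sequentially. collection_distance (X n) Q < a"
    proof eventually_elim
      case (elim n)
      then have "collections_within e (X n) Q"
        using collections_within_iff[of "X n" Q e] assms e(2) by simp
      then have "collection_distance (X n) Q \<le> ennreal e"
        unfolding collection_distance_def using e(2) by (intro INF_lower) auto
      then show ?case
        using b(2) e(1) by simp
    qed
  qed simp
qed

section \<open>The limit relation: reflexive, transitive and closed\<close>

lemma packing_compact: "compact K \<Longrightarrow> packing K P \<Longrightarrow> D \<in> P \<Longrightarrow> compact D"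
  using compact_copies by (auto simp: packing_iff)

lemma packing_translate:
  assumes "packing K P"
  shows "packing K (translate t P)"
proof -
  have "translate t P \<subseteq> copies K"
    using assms copies_image[OF isometry_translation[of t]] by (auto simp: packing_iff translate_def)
  moreover have "interior ((+) t ` D) \<inter> interior ((+) t ` E) = {}"
    if "D \<in> P" "E \<in> P" "(+) t ` D \<noteq> (+) t ` E" for D E
  proof -
    have "interior D \<inter> interior E = {}"
      using packing_eqI[OF assms that(1,2)] that(3) by blast
    then show ?thesis
      by (auto simp: interior_translation)
  qed
  ultimately show ?thesis
    by (auto simp: packing_iff translate_def pairwise_def)
qed

text \<open>One translate for each tolerance \<open>1 / Suc n\<close> already makes up a convergent
  sequence, so the order properties below can be proved one tolerance at a time.\<close>

lemma is_limit_of_iff: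
  assumes "compact K" "packing K A" "packing K B"
  shows "is_limit_of A B \<longleftrightarrow> (\<forall>e>0. \<exists>t. matched e (translate t B) A)"
proof -
  have conv: "collections_converge (\<lambda>n. translate (t n) B) A \<longleftrightarrow>
      (\<forall>e>0. \<forall>\<^sub>F n in sequentially. matched e (translate (t n) B) A)" for t
    using packing_compact[OF assms(1)] packing_translate assms(2,3)
    by (intro collections_converge_iff) blast+
  show ?thesis
  proof
    assume "is_limit_of A B"
    then show "\<forall>e>0. \<exists>t. matched e (translate t B) A"
      unfolding is_limit_of_def conv by (meson eventually_happens trivial_limit_sequentially)
  next
    assume "\<forall>e>0. \<exists>t. matched e (translate t B) A"
    then have "\<exists>t. matched (1 / Suc n) (translate t B) A" for n
      by simp
    then obtain t where t: "\<And>n. matched (1 / Suc n) (translate (t n) B) A"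
      by metis
    have "\<forall>\<^sub>F n in sequentially. matched e (translate (t n) B) A" if "0 < e" for e
    proof -
      have "\<forall>\<^sub>F n in sequentially. 1 / real (Suc n) < e"
        using that LIMSEQ_Suc[OF lim_1_over_n] by (intro order_tendstoD) auto
      then show ?thesis
        by eventually_elim (auto intro: matched_mono[OF t])
    qed
    then show "is_limit_of A B"
      unfolding is_limit_of_def conv by blast
  qed
qed

lemma is_limit_of_refl:
  assumes "compact K" "packing K A"
  shows "is_limit_of A A"
  unfolding is_limit_of_iff[OF assms assms(2)]
  by (metis less_imp_le matched_refl translate_0)

lemma matched_trans_half:
  assumes "matched d P Q" "matched d Q S" "0 < d" "d \<le> 1/2" "2 * d \<le> e"
  shows "matched e P S"
  using matched_mono[OF matched_trans[OF assms(1-4)]] assms(3,5) by simp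

lemma is_limit_of_trans:
  assumes "compact K" "packing K A" "packing K B" "packing K C"
    and "is_limit_of A B" "is_limit_of B C"
  shows "is_limit_of A C"
  unfolding is_limit_of_iff[OF assms(1,2,4)]
proof (intro allI impI)
  fix e :: real assume "0 < e"
  define d where "d = min (1/2) (e/2)"
  have d: "0 < d" "d \<le> 1/2" "2 * d \<le> e"
    using \<open>0 < e\<close> by (auto simp: d_def)
  obtain t where t: "matched d (translate t B) A"
    using assms(5) d(1) unfolding is_limit_of_iff[OF assms(1,2,3)] by blast
  \<comment> \<open>The shift \<open>t\<close> is fixed first; then \<open>C\<close> is approximated
    on a window enlarged by exactly \<open>norm t\<close>, so that after the shift the tolerance is
    still \<open>d\<close>.\<close>
  define c where "c = 1 / (1 / d + norm t)"
  have c: "0 < c" "c \<le> d" "1 / d + norm t \<le> 1 / c"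
    using d(1) by (auto simp: c_def field_simps add_pos_nonneg)
  obtain s where "matched c (translate s C) B"
    using assms(6) c(1) unfolding is_limit_of_iff[OF assms(1,3,4)] by blast
  then have "matched d (translate (t + s) C) (translate t B)"
    using matched_translate[OF _ c, of "translate s C" B] by (simp add: translate_translate)
  then show "\<exists>t. matched e (translate t C) A"
    using matched_trans_half[OF _ t d] by blast
qed

text \<open>This makes an accumulation point of a chain of successive limits a limit of every
  packing in the chain.\<close>

lemma is_limit_of_closed:
  assumes "compact K" "packing K A" "packing K C"
    and "\<And>e. 0 < e \<Longrightarrow> \<exists>B. packing K B \<and> is_limit_of B C \<and> matched e B A"
  shows "is_limit_of A C"
  unfolding is_limit_of_iff[OF assms(1-3)]
proof (intro allI impI)
  fix e :: real assume "0 < e"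
  define d where "d = min (1/2) (e/2)"
  have d: "0 < d" "d \<le> 1/2" "2 * d \<le> e"
    using \<open>0 < e\<close> by (auto simp: d_def)
  obtain B where B: "packing K B" "is_limit_of B C" "matched d B A"
    using assms(4)[OF d(1)] by blast
  then obtain t where "matched d (translate t C) B"
    using is_limit_of_iff[OF assms(1) B(1) assms(3)] d(1) by blast
  then show "\<exists>t. matched e (translate t C) A"
    using matched_trans_half[OF _ B(3) d] by blast
qed


subsection \<open>Sequential compactness of the space of packings\<close>

text \<open>The \<open>n\<close>-th refinement makes the \<open>n\<close>-th test constant. Beyond
  its first terms the diagonal sequence is a subsequence of that refinement, so each test is decided
  from some index on.\<close>

lemma diagonal_subsequence_bool:
  fixes T :: "nat \<Rightarrow> 'i \<Rightarrow> bool"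
  assumes "countable I"
  obtains r :: "nat \<Rightarrow> nat" where "strict_mono r"
    "\<And>i. i \<in> I \<Longrightarrow> (\<forall>\<^sub>F n in sequentially. T (r n) i) \<or> (\<forall>\<^sub>F n in sequentially. \<not> T (r n) i)"
proof -
  define P where "P n s \<longleftrightarrow> (\<forall>k. T (s k) (from_nat_into I n)) \<or> (\<forall>k. \<not> T (s k) (from_nat_into I n))"
    for n and s :: "nat \<Rightarrow> nat"
  interpret subseqs P
  proof
    fix n and s :: "nat \<Rightarrow> nat" assume "strict_mono s"
    show "\<exists>r'. strict_mono r' \<and> P n (s \<circ> r')"
    \<comment> \<open>A test that holds eventually holds throughout a tail; otherwise it fails
      infinitely often, and the indices of failure form the subsequence.\<close>
    proof (cases "\<forall>\<^sub>F k in sequentially. T (s k) (from_nat_into I n)")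
      case True
      then obtain N where "\<And>k. N \<le> k \<Longrightarrow> T (s k) (from_nat_into I n)"
        by (auto simp: eventually_sequentially)
      then show ?thesis
        by (intro exI[of _ "\<lambda>k. N + k"]) (auto simp: P_def strict_mono_def)
    next
      case False
      then show ?thesis
        using not_eventually_sequentiallyD[OF False] by (auto simp: P_def)
    qed
  qed
  have P: "P n (diagseq \<circ> ((+) (Suc n)))" for n
    by (rule diagseq_holds) (auto simp: P_def)
  have "(\<forall>\<^sub>F n in sequentially. T (diagseq n) i) \<or> (\<forall>\<^sub>F n in sequentially. \<not> T (diagseq n) i)"
    if i: "i \<in> I" for i
  proof -
    obtain n where n: "i = from_nat_into I n"
      using from_nat_into_surj[OF assms i] by metis
    have ev: "\<forall>\<^sub>F k in sequentially. Q (diagseq k)" if "\<forall>k. Q (diagseq (Suc n + k))" for Q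
      unfolding eventually_sequentially using that by (metis le_add_diff_inverse)
    show ?thesis
      using P[of n] ev[of "\<lambda>k. T k i"] ev[of "\<lambda>k. \<not> T k i"] unfolding P_def n o_def by fast
  qed
  then show ?thesis
    using that subseq_diagseq by blast
qed

text \<open>Finite subsets of a countable dense set stand in for arbitrary copies, which keeps the
  family of tests in the diagonal argument countable. The finite set arises from a cover of
  \<open>D\<close> by balls of radius \<open>e/2\<close> by moving each centre into
  \<open>S\<close>.\<close>

lemma compact_near_finite:
  fixes D S :: "'a::metric_space set"
  assumes "compact D" "0 < e" "\<And>U. open U \<Longrightarrow> U \<noteq> {} \<Longrightarrow> \<exists>d\<in>S. d \<in> U"
  obtains F where "finite F" "F \<subseteq> S" "near e D F"
proof -
  have "D \<subseteq> (\<Union>x\<in>D. ball x (e/2))"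
    using assms(2) by auto
  then obtain C where C: "C \<subseteq> D" "finite C" "D \<subseteq> (\<Union>x\<in>C. ball x (e/2))"
    using compactE_image[OF assms(1), of D "\<lambda>x. ball x (e/2)"] by auto
  have "\<exists>d\<in>S. d \<in> ball x (e/2)" for x
    using assms(2) by (intro assms(3)) auto
  then obtain d where d: "\<And>x. d x \<in> S" "\<And>x. dist x (d x) < e/2"
    by (metis mem_ball)
  have "near e D (d ` C)"
    unfolding near_def
  proof (intro conjI ballI)
    fix a assume "a \<in> D"
    then obtain x where x: "x \<in> C" "dist x a < e/2"
      using C(3) by auto
    then have "dist a (d x) \<le> e"
      using d(2)[of x] dist_triangle[of a "d x" x] by (simp add: dist_commute)
    then show "\<exists>b\<in>d ` C. dist a b \<le> e"
      using x(1) by blast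
  next
    fix b assume "b \<in> d ` C"
    then obtain x where x: "x \<in> C" "b = d x"
      by blast
    then have "dist x b \<le> e"
      using d(2)[of x] assms(2) by simp
    then show "\<exists>a\<in>D. dist a b \<le> e"
      using x(1) C(1) by blast
  qed
  then show ?thesis
    using that[of "d ` C"] C(2) d(1) by blast
qed

text \<open>Whether a packing has a member near a given finite set of points of a countable dense set is
  one of countably many tests; along a diagonal subsequence every test is eventually decided.
  The limit packing consists of the copies that are eventually approximated.\<close>

lemma packing_seq_compact:
  fixes X :: "nat \<Rightarrow> 'a::euclidean_space set set"
  assumes "compact K" "interior K \<noteq> {}" "\<And>n. packing K (X n)"
  obtains r Q where "strict_mono r" "packing K Q"
    "\<And>e. 0 < e \<Longrightarrow> \<forall>\<^sub>F n in sequentially. matched e (X (r n)) Q"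
proof -
  obtain S :: "'a set" where S: "countable S" "\<And>U. open U \<Longrightarrow> U \<noteq> {} \<Longrightarrow> \<exists>d\<in>S. d \<in> U"
    using countable_dense_setE by blast
  define T where "T n i \<longleftrightarrow> (\<exists>D\<in>X n. near (1 / Suc (snd i)) D (fst i))" for n i
  have "countable ({F. F \<subseteq> S \<and> finite F} \<times> (UNIV :: nat set))"
    using countable_Collect_finite_subset[OF S(1)] by (intro countable_SIGMA) (auto simp: conj_commute)
  then obtain r where r: "strict_mono r" and decided:
    "\<And>i. i \<in> {F. F \<subseteq> S \<and> finite F} \<times> UNIV \<Longrightarrow>
      (\<forall>\<^sub>F n in sequentially. T (r n) i) \<or> (\<forall>\<^sub>F n in sequentially. \<not> T (r n) i)"
    by (rule diagonal_subsequence_bool[where T = T]) blast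
  define Q where "Q = {D \<in> copies K. \<forall>e>0. \<forall>\<^sub>F n in sequentially. \<exists>D'\<in>X (r n). near e D' D}"
  have Q_approx: "\<forall>\<^sub>F n in sequentially. \<exists>D'\<in>X (r n). near e D' D" if "D \<in> Q" "0 < e" for D e
    using that by (simp add: Q_def)
  have X_copies: "D \<in> copies K" if "D \<in> X n" for D n
    using assms(3)[of n] that by (auto simp: packing_iff)
  \<comment> \<open>Because the tests are decided, being approximated infinitely often improves to
    being approximated eventually.\<close>
  have QI: "D \<in> Q" if D: "D \<in> copies K"
    and freq: "\<And>e. 0 < e \<Longrightarrow> \<exists>\<^sub>F n in sequentially. \<exists>D'\<in>X (r n). near e D' D" for D
    unfolding Q_def
  proof (intro CollectI conjI allI impI D)
    fix e :: real assume "0 < e"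
    then obtain k where k: "1 / Suc k < e/2"
      using reals_Archimedean[of "e/2"] by (auto simp: inverse_eq_divide)
    \<comment> \<open>\<open>F\<close> will be within \<open>d\<close> of \<open>D\<close>, and
      \<open>d\<close> is half the tolerance of test \<open>k\<close>. Sets within \<open>d\<close>
      of \<open>D\<close> therefore pass the test, and sets that pass it are within
      \<open>1 / Suc k + d\<close> of \<open>D\<close>, which is at most \<open>e\<close>.\<close>
    define d where "d = 1 / (2 * real (Suc k))"
    have d: "0 < d" "d + d = 1 / Suc k"
      by (auto simp: d_def field_simps)
    obtain F where F: "finite F" "F \<subseteq> S" "near d D F"
      using compact_near_finite[OF compact_copies[OF assms(1) D] d(1) S(2)] by blast
    have "\<exists>\<^sub>F n in sequentially. T (r n) (F, k)"
      using freq[OF d(1)]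
    proof (rule frequently_elim1)
      fix n assume "\<exists>D'\<in>X (r n). near d D' D"
      then show "T (r n) (F, k)"
        using near_trans[OF _ F(3)] d(2) unfolding T_def by (metis fst_conv snd_conv)
    qed
    then have "\<forall>\<^sub>F n in sequentially. T (r n) (F, k)"
      using decided[of "(F, k)"] F(1,2) by (auto simp: frequently_def)
    then show "\<forall>\<^sub>F n in sequentially. \<exists>D'\<in>X (r n). near e D' D"
    proof eventually_elim
      case (elim n)
      then obtain D' where "D' \<in> X (r n)" "near (1 / Suc k) D' F"
        by (auto simp: T_def)
      then have "near (1 / Suc k + d) D' D"
        using near_trans[OF _ F(3)[unfolded near_sym[of d D]]] by blast
      moreover have "1 / Suc k + d \<le> e"
        using k d by linarith
      ultimately show ?case
        using \<open>D' \<in> X (r n)\<close> near_mono by blast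
    qed
  qed
  have "packing K Q"
    unfolding packing_iff
  proof (intro conjI pairwiseI)
    show "Q \<subseteq> copies K"
      by (auto simp: Q_def)
    fix D E assume DE: "D \<in> Q" "E \<in> Q" "D \<noteq> E"
    have cDE: "D \<in> copies K" "E \<in> copies K"
      using DE by (auto simp: Q_def)
    show "interior D \<inter> interior E = {}"
    proof (rule ccontr)
      assume "interior D \<inter> interior E \<noteq> {}"
      then obtain x where x: "x \<in> interior D" "x \<in> interior E"
        by blast
      obtain a where a: "0 < a" "\<And>D'. D' \<in> copies K \<Longrightarrow> near a D' D \<Longrightarrow> x \<in> interior D'"
        using interior_stable[OF assms(1) cDE(1) x(1)] by blast
      obtain b where b: "0 < b" "\<And>D'. D' \<in> copies K \<Longrightarrow> near b D' E \<Longrightarrow> x \<in> interior D'"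
        using interior_stable[OF assms(1) cDE(2) x(2)] by blast
      obtain c where c: "0 < c" "\<not> near c D E"
        using near_all_imp_eq[of D E] compact_copies[OF assms(1)] cDE DE(3)
        by (metis compact_imp_closed)
      \<comment> \<open>The bounds by \<open>a\<close> and \<open>b\<close> put \<open>x\<close>
        into the interiors of both approximating members, which are then equal; the bound by
        \<open>c/2\<close> makes this contradict the distance between \<open>D\<close> and
        \<open>E\<close>.\<close>
      define e where "e = min (min a b) (c/2)"
      have e: "0 < e" "e \<le> a" "e \<le> b" "e + e \<le> c"
        using a(1) b(1) c(1) by (auto simp: e_def)
      have "\<forall>\<^sub>F n in sequentially. (\<exists>D'\<in>X (r n). near e D' D) \<and> (\<exists>E'\<in>X (r n). near e E' E)"
        using Q_approx[OF DE(1) e(1)] Q_approx[OF DE(2) e(1)] by (rule eventually_conj)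
      then obtain n D' E' where D': "D' \<in> X (r n)" "near e D' D" and E': "E' \<in> X (r n)" "near e E' E"
        by (auto dest: eventually_happens)
      have "x \<in> interior D'" "x \<in> interior E'"
        using a(2) b(2) D' E' X_copies near_mono e by blast+
      then have "D' = E'"
        using packing_eqI[OF assms(3) D'(1) E'(1)] by blast
      then have "near (e + e) D E"
        using near_trans[of e D D' e E] D'(2) E'(2) near_sym by blast
      then show False
        using c(2) e(4) near_mono by blast
    qed
  qed
  obtain s where s: "0 < s"
    "\<And>D E. D \<in> copies K \<Longrightarrow> E \<in> copies K \<Longrightarrow> near s D E \<Longrightarrow> interior D \<inter> interior E \<noteq> {}"
    using copies_separated[OF assms(1,2)] by blast
  have sep: "D = E" if "packing K P" "D \<in> P" "E \<in> P" "near s D E" for P D E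
    using packing_eqI[OF that(1-3)] s(2)[OF _ _ that(4)] that(1-3) by (auto simp: packing_iff)
  have "K \<noteq> {}"
    using assms(2) by auto
  then have nonempty: "D \<noteq> {}" if "D \<in> copies K" for D
    using that by (auto simp: copies_def)
  have "\<forall>\<^sub>F n in sequentially. matched e (X (r n)) Q" if "0 < e" for e
  proof -
    \<comment> \<open>With half the separation distance, two members of one packing that are within
      \<open>d\<close> of a common set are within \<open>s\<close> of each other and hence equal;
      this is the uniqueness of partners.\<close>
    define d where "d = min e (s/2)"
    have d: "0 < d" "d \<le> e" "d + d \<le> s"
      using \<open>0 < e\<close> s(1) by (auto simp: d_def)
    have "finite {B \<in> Q. B \<inter> cball 0 (1 / e) \<noteq> {}}"
      by (rule packing_locally_finite[OF assms(1,2) \<open>packing K Q\<close>])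
    moreover have "{B \<in> Q. B \<subseteq> cball 0 (1 / e)} \<subseteq> {B \<in> Q. B \<inter> cball 0 (1 / e) \<noteq> {}}"
      using nonempty by (auto simp: Q_def)
    ultimately have "finite {B \<in> Q. B \<subseteq> cball 0 (1 / e)}"
      by (rule rev_finite_subset)
    then have ev_Q: "\<forall>\<^sub>F n in sequentially. \<forall>B\<in>{B \<in> Q. B \<subseteq> cball 0 (1 / e)}. \<exists>A\<in>X (r n). near d A B"
      by (rule eventually_ball_finite) (auto intro: Q_approx d(1))
    \<comment> \<open>The members of \<open>X (r n)\<close> vary with \<open>n\<close>, so
      finiteness in each packing does not help here. Instead, unmatched members in the window would
      accumulate at a copy \<open>E\<close>; being approximated infinitely often, \<open>E\<close>
      belongs to \<open>Q\<close> and matches some of them.\<close>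
    have ev_X: "\<forall>\<^sub>F n in sequentially. \<forall>A\<in>X (r n). A \<subseteq> cball 0 (1 / e) \<longrightarrow> (\<exists>B\<in>Q. near d A B)"
    proof (rule ccontr)
      assume "\<not> ?thesis"
      then obtain u :: "nat \<Rightarrow> nat" where u: "strict_mono u"
        "\<And>n. \<exists>A\<in>X (r (u n)). A \<subseteq> cball 0 (1 / e) \<and> (\<forall>B\<in>Q. \<not> near d A B)"
        using not_eventually_sequentiallyD by (smt (verit, best))
      obtain A where A: "\<And>n. A n \<in> X (r (u n))" "\<And>n. A n \<subseteq> cball 0 (1 / e)"
        "\<And>n B. B \<in> Q \<Longrightarrow> \<not> near d (A n) B"
        using u(2) by metis
      have "A n \<in> copies K" "A n \<inter> cball 0 (1 / e) \<noteq> {}" for n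
        using X_copies[OF A(1)[of n]] nonempty A(2)[of n] by auto
      then obtain v E where v: "strict_mono v" "E \<in> copies K"
        "\<And>e. 0 < e \<Longrightarrow> \<forall>\<^sub>F n in sequentially. near e (A (v n)) E"
        using copies_seq_compact[OF assms(1), of A "1 / e"] by metis
      have "E \<in> Q"
      proof (rule QI[OF v(2)])
        fix c :: real assume "0 < c"
        show "\<exists>\<^sub>F n in sequentially. \<exists>D'\<in>X (r n). near c D' E"
          unfolding frequently_def
        proof
          assume "\<forall>\<^sub>F n in sequentially. \<not> (\<exists>D'\<in>X (r n). near c D' E)"
          then have "\<forall>\<^sub>F n in sequentially. \<not> (\<exists>D'\<in>X (r ((u \<circ> v) n)). near c D' E)"
            by (rule eventually_subseq[OF strict_mono_o[OF u(1) v(1)]])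
          then have "\<forall>\<^sub>F n in sequentially. False"
            using v(3)[OF \<open>0 < c\<close>]
          proof eventually_elim
            case (elim n)
            then show ?case
              using A(1)[of "v n"] by auto
          qed
          then show False by simp
        qed
      qed
      moreover obtain n where "near d (A (v n)) E"
        using v(3)[OF d(1)] by (auto dest: eventually_happens)
      ultimately show False
        using A(3) by blast
    qed
    show ?thesis
      using ev_Q ev_X
    proof eventually_elim
      case (elim n)
      have near_s: "near s A C" if "near d A B" "near d B C" for A B C :: "'a set"
        using near_mono[OF near_trans[OF that] d(3)] .
      have uniq_B: "B = B'" if "B \<in> Q" "B' \<in> Q" "near d A B" "near d A B'" for A B B'
        using that near_sym by (intro sep[OF \<open>packing K Q\<close> that(1,2)] near_s[of B A B']) blast+
      have uniq_A: "A = A'" if "A \<in> X (r n)" "A' \<in> X (r n)" "near d A B" "near d A' B" for A A' B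
        using that near_sym by (intro sep[OF assms(3) that(1,2)] near_s[of A B A']) blast+
      show ?case
      proof (rule matchedI[where R = "\<lambda>A B. A \<in> X (r n) \<and> B \<in> Q \<and> near d A B"])
        show "A \<in> X (r n) \<and> B \<in> Q \<and> near e A B"
          if "A \<in> X (r n) \<and> B \<in> Q \<and> near d A B" for A B
          using that near_mono[OF _ d(2)] by blast
        show "\<exists>!B. A \<in> X (r n) \<and> B \<in> Q \<and> near d A B"
          if A: "A \<in> X (r n)" "A \<subseteq> cball 0 (1 / e)" for A
        proof -
          obtain B where "B \<in> Q" "near d A B"
            using elim(2) A by blast
          then show ?thesis
            using A(1) uniq_B by (intro ex1I[of _ B]) blast+
        qed
        show "\<exists>!A. A \<in> X (r n) \<and> B \<in> Q \<and> near d A B"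
          if B: "B \<in> Q" "B \<subseteq> cball 0 (1 / e)" for B
        proof -
          obtain A where "A \<in> X (r n)" "near d A B"
            using elim(1) B by blast
          then show ?thesis
            using B(1) uniq_A by (intro ex1I[of _ A]) blast+
        qed
      qed
    qed
  qed
  then show ?thesis
    using that r \<open>packing K Q\<close> by blast
qed


subsection \<open>Uniformly recurrent limits\<close>

text \<open>Comparing two arbitrary limits of \<open>A\<close>, rather than a limit with
  \<open>A\<close> itself, makes the property pass to every limit of a packing of a compact
  \<open>K\<close>: later stages of the construction do not spoil earlier ones.\<close>

definition recurrent_upto :: "'a::euclidean_space set \<Rightarrow> real \<Rightarrow> 'a set set \<Rightarrow> bool" where
  "recurrent_upto K e A \<longleftrightarrow>
     (\<forall>B C. packing K B \<and> packing K C \<and> is_limit_of B A \<and> is_limit_of C A \<longrightarrow>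
        (\<exists>t. matched e (translate t B) C))"

lemma is_limit_of_chain:
  assumes "compact K" "\<And>n. packing K (X n)" "\<And>n. is_limit_of (X (Suc n)) (X n)" "m \<le> n"
  shows "is_limit_of (X n) (X m)"
  using assms(4)
proof (induction n rule: dec_induct)
  case base
  show ?case
    by (rule is_limit_of_refl[OF assms(1,2)])
next
  case (step n)
  show ?case
    by (rule is_limit_of_trans[OF assms(1,2,2,2) assms(3) step.IH])
qed

text \<open>If no limit of a packing were recurrent up to \<open>e\<close>, then iterating would produce an infinite
  sequence of packings that are pairwise far apart, contradicting compactness.\<close>

lemma recurrent_upto_exists:
  assumes "compact K" "interior K \<noteq> {}" "packing K A" "0 < e"
  shows "\<exists>B. packing K B \<and> is_limit_of B A \<and> recurrent_upto K e B"
proof (rule ccontr)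
  assume none: "\<not> ?thesis"
  have "\<exists>f. \<forall>n. (packing K (f n) \<and> is_limit_of (f n) A) \<and> (is_limit_of (f (Suc n)) (f n) \<and>
      (\<exists>C. packing K C \<and> is_limit_of C (f n) \<and> (\<forall>t. \<not> matched e (translate t (f (Suc n))) C)))"
  proof (rule dependent_nat_choice)
    show "\<exists>B. packing K B \<and> is_limit_of B A"
      using is_limit_of_refl assms by blast
    fix B and n :: nat assume B: "packing K B \<and> is_limit_of B A"
    then have "\<not> recurrent_upto K e B"
      using none by blast
    then obtain B' C where C: "packing K B'" "packing K C" "is_limit_of B' B" "is_limit_of C B"
      "\<forall>t. \<not> matched e (translate t B') C"
      unfolding recurrent_upto_def by blast
    moreover have "is_limit_of B' A"
      using is_limit_of_trans[OF assms(1) C(1) _ assms(3) C(3)] B by blast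
    ultimately show "\<exists>B'. (packing K B' \<and> is_limit_of B' A) \<and> (is_limit_of B' B \<and>
      (\<exists>C. packing K C \<and> is_limit_of C B \<and> (\<forall>t. \<not> matched e (translate t B') C)))"
      by blast
  qed
  then obtain f where chain: "\<forall>n. (packing K (f n) \<and> is_limit_of (f n) A) \<and> (is_limit_of (f (Suc n)) (f n) \<and>
      (\<exists>C. packing K C \<and> is_limit_of C (f n) \<and> (\<forall>t. \<not> matched e (translate t (f (Suc n))) C)))" ..
  have f: "packing K (f n)" "is_limit_of (f (Suc n)) (f n)"
    "\<exists>C. packing K C \<and> is_limit_of C (f n) \<and> (\<forall>t. \<not> matched e (translate t (f (Suc n))) C)" for n
    using chain[THEN spec, of n] by simp_all
  have "\<exists>C. \<forall>n. packing K (C n) \<and> is_limit_of (C n) (f n) \<and>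
      (\<forall>t. \<not> matched e (translate t (f (Suc n))) (C n))"
    by (rule choice) (intro allI f(3))
  then obtain C where far: "\<forall>n. packing K (C n) \<and> is_limit_of (C n) (f n) \<and>
      (\<forall>t. \<not> matched e (translate t (f (Suc n))) (C n))" ..
  have C: "packing K (C n)" "is_limit_of (C n) (f n)"
    "\<And>t. \<not> matched e (translate t (f (Suc n))) (C n)" for n
    using far[THEN spec, of n] by simp_all
  obtain r Q where r: "strict_mono r" and Q:
    "\<And>e. 0 < e \<Longrightarrow> \<forall>\<^sub>F n in sequentially. matched e (C (r n)) Q"
    using packing_seq_compact[OF assms(1,2), of C] C(1) by metis
  \<comment> \<open>Two triangle inequalities lie ahead, one through \<open>Q\<close> and one
    through \<open>C (r (Suc N))\<close>. Each doubles the tolerance, hence the two halvings to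
    \<open>d\<close> and \<open>c\<close>.\<close>
  define d where "d = min (1/2) (e/2)"
  have d: "0 < d" "d \<le> 1/2" "2 * d \<le> e"
    using assms(4) by (auto simp: d_def)
  define c where "c = d/2"
  have c: "0 < c" "c \<le> 1/2" "2 * c \<le> d"
    using d by (auto simp: c_def)
  obtain N where N: "\<And>n. N \<le> n \<Longrightarrow> matched c (C (r n)) Q"
    using Q[OF c(1)] by (auto simp: eventually_sequentially)
  have close: "matched d (C (r (Suc N))) (C (r N))"
    using matched_trans_half[OF N matched_sym[OF N] c] by simp
  \<comment> \<open>No translate of \<open>f (Suc (r N))\<close> is within \<open>e\<close> of
    \<open>C (r N)\<close>. But \<open>C (r (Suc N))\<close> is a limit of that packing and close to
    \<open>C (r N)\<close>, which yields such a translate.\<close>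
  have "Suc (r N) \<le> r (Suc N)"
    using r by (simp add: Suc_leI strict_mono_less)
  then have "is_limit_of (f (r (Suc N))) (f (Suc (r N)))"
    by (rule is_limit_of_chain[where X = f, OF assms(1) f(1,2)])
  then have "is_limit_of (C (r (Suc N))) (f (Suc (r N)))"
    by (rule is_limit_of_trans[OF assms(1) C(1) f(1) f(1) C(2)])
  then obtain t where "matched d (translate t (f (Suc (r N)))) (C (r (Suc N)))"
    using is_limit_of_iff[OF assms(1) C(1) f(1)] d(1) by blast
  then have "matched e (translate t (f (Suc (r N)))) (C (r N))"
    using close d by (rule matched_trans_half)
  then show False
    using C(3) by blast
qed

lemma uniformly_recurrent_limit_exists:
  assumes "compact K" "interior K \<noteq> {}" "packing K P"
  shows "\<exists>Q. uniformly_recurrent K Q \<and> is_limit_of Q P"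
proof -
  have "\<exists>X. \<forall>n. (packing K (X n) \<and> is_limit_of (X n) P) \<and>
      (is_limit_of (X (Suc n)) (X n) \<and> recurrent_upto K (1 / Suc n) (X (Suc n)))"
  proof (rule dependent_nat_choice)
    show "\<exists>B. packing K B \<and> is_limit_of B P"
      using is_limit_of_refl assms by blast
    fix B and n :: nat assume B: "packing K B \<and> is_limit_of B P"
    then obtain B' where "packing K B'" "is_limit_of B' B" "recurrent_upto K (1 / Suc n) B'"
      using recurrent_upto_exists[OF assms(1,2), of B "1 / Suc n"] by auto
    then show "\<exists>B'. (packing K B' \<and> is_limit_of B' P) \<and>
        (is_limit_of B' B \<and> recurrent_upto K (1 / Suc n) B')"
      using is_limit_of_trans[OF assms(1) _ _ assms(3)] B by blast
  qed
  then obtain X where chain: "\<forall>n. (packing K (X n) \<and> is_limit_of (X n) P) \<and>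
      (is_limit_of (X (Suc n)) (X n) \<and> recurrent_upto K (1 / Suc n) (X (Suc n)))" ..
  have X: "packing K (X n)" "is_limit_of (X n) P"
    "is_limit_of (X (Suc n)) (X n)" "recurrent_upto K (1 / Suc n) (X (Suc n))" for n
    using chain[THEN spec, of n] by simp_all
  obtain r Q where r: "strict_mono r" and Q: "packing K Q"
    "\<And>e. 0 < e \<Longrightarrow> \<forall>\<^sub>F n in sequentially. matched e (X (r n)) Q"
    using packing_seq_compact[OF assms(1,2), of X] X(1) by blast
  \<comment> \<open>From index \<open>n\<close> on, the chain consists of limits of
    \<open>X n\<close>, and its subsequence comes arbitrarily close to \<open>Q\<close>.\<close>
  have lim: "is_limit_of Q (X n)" for n
  proof (rule is_limit_of_closed[OF assms(1) Q(1) X(1)])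
    fix e :: real assume "0 < e"
    then obtain N where N: "\<And>k. N \<le> k \<Longrightarrow> matched e (X (r k)) Q"
      using Q(2) by (auto simp: eventually_sequentially)
    have "n \<le> r (max n N)"
      using seq_suble[OF r, of "max n N"] by simp
    then have "is_limit_of (X (r (max n N))) (X n)"
      by (rule is_limit_of_chain[where X = X, OF assms(1) X(1,3)])
    then show "\<exists>B. packing K B \<and> is_limit_of B (X n) \<and> matched e B Q"
      using X(1) N[of "max n N"] by auto
  qed
  have "is_limit_of Q B" if B: "packing K B" "is_limit_of B Q" for B
    unfolding is_limit_of_iff[OF assms(1) Q(1) B(1)]
  proof (intro allI impI)
    fix e :: real assume "0 < e"
    then obtain n where n: "1 / Suc n < e"
      using reals_Archimedean[of e] by (auto simp: inverse_eq_divide)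
    have "is_limit_of B (X (Suc n))"
      using is_limit_of_trans[OF assms(1) B(1) Q(1) X(1) B(2) lim] .
    then obtain t where "matched (1 / Suc n) (translate t B) Q"
      using X(4)[of n] lim[of "Suc n"] B(1) Q(1) unfolding recurrent_upto_def by blast
    then show "\<exists>t. matched e (translate t B) Q"
      using matched_mono n by (metis less_imp_le of_nat_0_less_iff zero_less_Suc zero_less_divide_1_iff)
  qed
  moreover have "is_limit_of Q P"
    by (rule is_limit_of_trans[OF assms(1) Q(1) X(1) assms(3) lim X(2)])
  ultimately show ?thesis
    using Q(1) unfolding uniformly_recurrent_def by blast
qed


subsection \<open>Volumes of congruent copies\<close>

text \<open>By Vitali's covering theorem an open set is a disjoint union of balls up to a null set, and
  isometries preserve the volume of balls.\<close>

lemma emeasure_isometry_open_le: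
  fixes U :: "'a::euclidean_space set"
  assumes "isometry f" "open U"
  shows "emeasure lebesgue U \<le> emeasure lebesgue (f ` U)"
proof -
  let ?B = "\<lambda>i :: 'a \<times> real. ball (fst i) (snd i)"
  let ?I = "{i. 0 < snd i \<and> ?B i \<subseteq> U}"
  have "\<exists>i. i \<in> ?I \<and> x \<in> ball (fst i) (snd i) \<and> snd i < d" if "x \<in> U" "0 < d" for x d
  proof -
    obtain r where r: "0 < r" "ball x r \<subseteq> U"
      using assms(2) \<open>x \<in> U\<close> open_contains_ball by blast
    have "ball x (min r (d/2)) \<subseteq> U"
      using r(2) by (meson min.cobounded1 order_trans subset_ball)
    then show ?thesis
      using r(1) that by (intro exI[of _ "(x, min r (d/2))"]) (auto simp: min_def)
  qed
  then obtain C where C: "countable C" "C \<subseteq> ?I" "pairwise (\<lambda>i j. disjnt (?B i) (?B j)) C"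
    "negligible (U - (\<Union>i\<in>C. ?B i))"
    by (rule Vitali_covering_theorem_balls)
  have img: "f ` ?B i = ball (f (fst i)) (snd i)" for i
    by (rule isometry_image_ball[OF assms(1)])
  have disj: "disjoint_family_on ?B C"
    using C(3) by (auto simp: disjoint_family_on_def pairwise_def disjnt_def)
  have disj': "disjoint_family_on (\<lambda>i. f ` ?B i) C"
    using disj isometry_bij[OF assms(1), THEN bij_is_inj]
    by (simp add: disjoint_family_on_def image_Int[symmetric])
  have ball_eq: "emeasure lebesgue (f ` ?B i) = emeasure lebesgue (?B i)" if "i \<in> C" for i
    using C(2) that by (subst img) (auto simp: emeasure_ball)
  have "open (f ` U)"
    using isometry_image_interior[OF assms(1), of U] assms(2)
    by (metis interior_open open_interior)
  have "emeasure lebesgue U \<le> emeasure lebesgue ((\<Union>i\<in>C. ?B i) \<union> (U - (\<Union>i\<in>C. ?B i)))"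
    using assms(2) C(1) by (intro emeasure_mono) (auto intro!: sets.Un sets.Diff sets.countable_UN')
  also have "\<dots> = emeasure lebesgue (\<Union>i\<in>C. ?B i)"
    using C(1,4) by (intro emeasure_Un_null_set) (auto simp: negligible_iff_null_sets intro!: sets.countable_UN')
  also have "\<dots> = (\<integral>\<^sup>+i. emeasure lebesgue (?B i) \<partial>count_space C)"
    using C(1) disj by (intro emeasure_UN_countable) auto
  also have "\<dots> = (\<integral>\<^sup>+i. emeasure lebesgue (f ` ?B i) \<partial>count_space C)"
    by (intro nn_integral_cong) (simp add: ball_eq)
  also have "\<dots> = emeasure lebesgue (\<Union>i\<in>C. f ` ?B i)"
    using C(1) disj' by (intro emeasure_UN_countable[symmetric]) (auto simp: img)
  also have "\<dots> \<le> emeasure lebesgue (f ` U)"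
    using C(2) \<open>open (f ` U)\<close> by (intro emeasure_mono) auto
  finally show ?thesis .
qed

lemma emeasure_isometry_open:
  fixes U :: "'a::euclidean_space set"
  assumes "isometry f" "open U"
  shows "emeasure lebesgue (f ` U) = emeasure lebesgue U"
proof (rule antisym)
  have "open (f ` U)"
    using isometry_image_interior[OF assms(1), of U] assms(2)
    by (metis interior_open open_interior)
  moreover have "inv f ` f ` U = U"
    using isometry_bij[OF assms(1)] by (simp add: bij_is_inj image_inv_f_f)
  ultimately show "emeasure lebesgue (f ` U) \<le> emeasure lebesgue U"
    using emeasure_isometry_open_le[OF isometry_inv[OF assms(1)], of "f ` U"] by simp
qed (rule emeasure_isometry_open_le[OF assms])

text \<open>A compact set is an open ball minus an open subset, and the volumes of both are
  preserved.\<close>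

lemma measure_isometry_compact:
  fixes K :: "'a::euclidean_space set"
  assumes "isometry f" "compact K"
  shows "measure lebesgue (f ` K) = measure lebesgue K"
proof -
  obtain R where R: "K \<subseteq> ball 0 R"
    using compact_imp_bounded[OF assms(2)] bounded_subset_ballD by blast
  have cfK: "compact (f ` K)"
    using assms by (intro compact_continuous_image isometry_continuous)
  have opn: "open (ball 0 R - K)"
    using assms(2) by (intro open_Diff compact_imp_closed) auto
  have "measure lebesgue (f ` K) = measure lebesgue (f ` ball 0 R - f ` (ball 0 R - K))"
    using R isometry_bij[OF assms(1), THEN bij_is_inj]
    by (intro arg_cong[of _ _ "measure lebesgue"]) (auto simp: inj_def)
  also have "\<dots> = measure lebesgue (f ` ball 0 R) - measure lebesgue (f ` (ball 0 R - K))"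
  proof (rule measurable_measure_Diff)
    show "f ` ball 0 R \<in> lmeasurable"
      by (simp add: isometry_image_ball[OF assms(1)])
    have "open (f ` (ball 0 R - K))"
      using isometry_image_interior[OF assms(1), of "ball 0 R - K"] opn
      by (metis interior_open open_interior)
    then show "f ` (ball 0 R - K) \<in> sets lebesgue"
      by simp
  qed auto
  also have "\<dots> = measure lebesgue (ball (0 :: 'a) R) - measure lebesgue (ball 0 R - K)"
    unfolding measure_def using opn by (simp only: emeasure_isometry_open[OF assms(1)] open_ball)
  also have "\<dots> = measure lebesgue K"
    using measurable_measure_Diff[of "ball 0 R" lebesgue K] R assms(2)
    by (simp add: lmeasurable_compact fmeasurableD)
  finally show ?thesis .
qed

lemma measure_copies: "compact K \<Longrightarrow> D \<in> copies K \<Longrightarrow> measure lebesgue D = measure lebesgue K"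
  by (auto simp: copies_def measure_isometry_compact)

text \<open>Outer regularity encloses \<open>D\<close> in an open set \<open>T\<close> of little
  more volume, and sets close enough to the compact \<open>D\<close> stay inside \<open>T\<close>.
  Only an upper bound can hold in this generality, as finite sets can be close to
  \<open>D\<close>.\<close>

lemma measure_near_le:
  fixes D :: "'a::euclidean_space set"
  assumes "compact D" "W \<in> sets lebesgue" "0 < \<eta>"
  shows "\<exists>e>0. \<forall>D'. compact D' \<and> near e D' D \<longrightarrow>
    measure lebesgue (W \<inter> D') \<le> measure lebesgue (W \<inter> D) + \<eta>"
proof -
  have D: "D \<in> lmeasurable"
    by (rule lmeasurable_compact[OF assms(1)])
  obtain T where T: "open T" "D \<subseteq> T" "T - D \<in> lmeasurable" "emeasure lebesgue (T - D) < ennreal \<eta>"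
    using sets_lebesgue_outer_open[OF fmeasurableD[OF D] assms(3)] by blast
  have small: "measure lebesgue (T - D) \<le> \<eta>"
    using T(3,4) assms(3) by (simp add: emeasure_eq_measure2 ennreal_less_iff)
  obtain e where e: "0 < e" "(\<Union>x\<in>D. cball x e) \<subseteq> T"
    using compact_subset_open_imp_cball_epsilon_subset[OF assms(1) T(1,2)] by blast
  have "measure lebesgue (W \<inter> D') \<le> measure lebesgue (W \<inter> D) + \<eta>"
    if D': "compact D'" "near e D' D" for D'
  proof -
    have "D' \<subseteq> T"
      using D'(2) e(2) by (fastforce simp: near_def dist_commute)
    have WD: "W \<inter> D \<in> lmeasurable"
      using D assms(2) by (simp add: fmeasurable_Int_fmeasurable Int_commute)
    have "measure lebesgue (W \<inter> D') \<le> measure lebesgue ((W \<inter> D) \<union> (T - D))"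
      using \<open>D' \<subseteq> T\<close> assms(2) lmeasurable_compact[OF D'(1)] WD T(3)
      by (intro measure_mono_fmeasurable) (auto simp: fmeasurableD)
    also have "\<dots> \<le> measure lebesgue (W \<inter> D) + measure lebesgue (T - D)"
      using WD T(3) by (intro measure_Un_le) (auto simp: fmeasurableD)
    finally show ?thesis
      using small by simp
  qed
  then show ?thesis
    using e(1) by blast
qed

text \<open>Upper semicontinuity holds for \<open>W\<close> and for its complement; as the total volume of a copy is
  fixed, both inequalities together give continuity even if \<open>K\<close> has a boundary of positive volume.\<close>

lemma measure_copies_continuous:
  fixes K :: "'a::euclidean_space set"
  assumes "compact K" "D \<in> copies K" "W \<in> sets lebesgue" "0 < \<eta>"
  shows "\<exists>e>0. \<forall>D'\<in>copies K. near e D' D \<longrightarrow>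
    \<bar>measure lebesgue (W \<inter> D') - measure lebesgue (W \<inter> D)\<bar> \<le> \<eta>"
proof -
  have D: "compact D"
    by (rule compact_copies[OF assms(1,2)])
  have W': "- W \<in> sets lebesgue"
    using sets.compl_sets[OF assms(3)] by (simp add: Compl_eq_Diff_UNIV)
  obtain a where a: "0 < a" "\<And>D'. compact D' \<Longrightarrow> near a D' D \<Longrightarrow>
      measure lebesgue (W \<inter> D') \<le> measure lebesgue (W \<inter> D) + \<eta>"
    using measure_near_le[OF D assms(3,4)] by blast
  obtain b where b: "0 < b" "\<And>D'. compact D' \<Longrightarrow> near b D' D \<Longrightarrow>
      measure lebesgue (- W \<inter> D') \<le> measure lebesgue (- W \<inter> D) + \<eta>"
    using measure_near_le[OF D W' assms(4)] by blast
  have split: "measure lebesgue K = measure lebesgue (W \<inter> E) + measure lebesgue (- W \<inter> E)"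
    if "E \<in> copies K" for E
  proof -
    have E: "E \<in> lmeasurable"
      by (rule lmeasurable_compact[OF compact_copies[OF assms(1) that]])
    have "measure lebesgue ((W \<inter> E) \<union> (- W \<inter> E)) = measure lebesgue (W \<inter> E) + measure lebesgue (- W \<inter> E)"
      using E assms(3) W'
      by (intro measure_Un2[THEN trans])
         (auto simp: fmeasurable_Int_fmeasurable Int_commute intro!: arg_cong2[of _ _ _ _ "(+)"] arg_cong[of _ _ "measure lebesgue"])
    moreover have "(W \<inter> E) \<union> (- W \<inter> E) = E"
      by blast
    ultimately show ?thesis
      using measure_copies[OF assms(1) that] by simp
  qed
  have "\<bar>measure lebesgue (W \<inter> D') - measure lebesgue (W \<inter> D)\<bar> \<le> \<eta>"
    if D': "D' \<in> copies K" "near (min a b) D' D" for D'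
  proof -
    have "compact D'" "near a D' D" "near b D' D"
      using compact_copies[OF assms(1) D'(1)] near_mono[OF D'(2)] by auto
    then show ?thesis
      using a(2)[of D'] b(2)[of D'] split[OF D'(1)] split[OF assms(2)] by linarith
  qed
  then show ?thesis
    using a(1) b(1) by (intro exI[of _ "min a b"]) auto
qed


subsection \<open>Density under limits\<close>

lemma ball_density_translate:
  "ball_density (translate t P) r p = ball_density P r (p - t)"
proof -
  have cball: "cball p r = (+) t ` cball (p - t) r"
    by simp
  have inj: "inj_on ((`) ((+) t)) P"
    by (simp add: inj_on_def inj_image_eq_iff)
  have "measure lebesgue (cball p r \<inter> (+) t ` D) = measure lebesgue (cball (p - t) r \<inter> D)" for D
    unfolding cball by (subst image_Int[symmetric]) (auto simp: measure_translation)
  moreover have "measure lebesgue (cball p r) = measure lebesgue (cball (p - t) r)"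
    unfolding cball by (rule measure_translation)
  ultimately show ?thesis
    unfolding ball_density_def translate_def
    by (subst infsum_reindex[OF inj]) (simp_all add: o_def)
qed

text \<open>Finitely many members of \<open>Q\<close> matter for a fixed ball. The matching pairs
  them with all members of \<open>P\<close> that can contribute, and each pair contributes nearly
  equal volumes.\<close>

lemma mass_continuous:
  fixes K :: "'a::euclidean_space set"
  assumes "compact K" "interior K \<noteq> {}" "packing K Q" "0 < \<eta>"
  shows "\<exists>e>0. \<forall>P. packing K P \<and> matched e P Q \<longrightarrow>
    \<bar>(\<Sum>\<^sub>\<infinity>D\<in>P. measure lebesgue (cball p r \<inter> D)) - (\<Sum>\<^sub>\<infinity>D\<in>Q. measure lebesgue (cball p r \<inter> D))\<bar> \<le> \<eta>"
proof -
  define m where "m D = measure lebesgue (cball p r \<inter> D)" for D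
  define \<rho> where "\<rho> = norm p + \<bar>r\<bar>"
  have ball_sub: "cball p r \<subseteq> cball 0 \<rho>"
  proof
    fix x assume "x \<in> cball p r"
    then show "x \<in> cball 0 \<rho>"
      using dist_triangle[of 0 x p] by (simp add: \<rho>_def)
  qed
  then have m0: "m D = 0" if "D \<inter> cball 0 \<rho> = {}" for D
    using that by (metis disjoint_iff m_def measure_empty subsetD Int_emptyI)
  obtain w where w: "0 < w" "\<And>D r. D \<in> copies K \<Longrightarrow> D \<inter> cball 0 r \<noteq> {} \<Longrightarrow> D \<subseteq> cball 0 (r + w)"
    using copies_subset_cball[OF assms(1)] by blast
  \<comment> \<open>The margin 1 is needed because a member of \<open>P\<close> that meets the ball
    of radius \<rho> may have a partner that misses it by up to \<open>e\<close>, which will be at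
    most 1.\<close>
  define S where "S = {D \<in> Q. D \<inter> cball 0 (\<rho> + 1) \<noteq> {}}"
  have "finite S"
    unfolding S_def by (rule packing_locally_finite[OF assms(1-3)])
  have "S \<subseteq> Q"
    by (auto simp: S_def)
  then have S_copies: "D \<in> copies K" if "D \<in> S" for D
    using assms(3) that by (auto simp: packing_iff)
  have "0 \<le> \<rho>"
    by (simp add: \<rho>_def)
  \<comment> \<open>The error is shared among the members of \<open>S\<close>; the added 1 avoids
    division by zero when \<open>S\<close> is empty.\<close>
  define h where "h = \<eta> / (card S + 1)"
  have "0 < h"
    using assms(4) by (simp add: h_def)
  have "\<exists>c>0. \<forall>D'\<in>copies K. near c D' D \<longrightarrow> \<bar>m D' - m D\<bar> \<le> h" if "D \<in> S" for D
    unfolding m_def by (rule measure_copies_continuous[OF assms(1) S_copies[OF that] _ \<open>0 < h\<close>]) simp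
  then obtain c where c: "\<And>D. D \<in> S \<Longrightarrow> 0 < c D"
    "\<And>D D'. D \<in> S \<Longrightarrow> D' \<in> copies K \<Longrightarrow> near (c D) D' D \<Longrightarrow> \<bar>m D' - m D\<bar> \<le> h"
    by metis
  \<comment> \<open>Members of \<open>S\<close> lie within radius \<open>\<rho> + 1 + w\<close> and
    their partners within \<open>\<rho> + w + 2\<close>, so this bound keeps both in the window
    where partners are unique.\<close>
  define e where "e = Min (insert (1 / (\<rho> + w + 2)) (c ` S))"
  have "0 < e"
    unfolding e_def using \<open>finite S\<close> c(1) \<open>0 \<le> \<rho>\<close> w(1) by (subst Min_gr_iff) auto
  have e_c: "e \<le> c D" if "D \<in> S" for D
    unfolding e_def using \<open>finite S\<close> that by (intro Min_le) auto
  have e_le: "e \<le> 1 / (\<rho> + w + 2)"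
    unfolding e_def using \<open>finite S\<close> by (intro Min_le) auto
  then have "e \<le> 1"
    using \<open>0 \<le> \<rho>\<close> w(1) by (smt (verit) divide_le_eq_1)
  have e_inv: "\<rho> + w + 2 \<le> 1 / e"
    using e_le \<open>0 < e\<close> \<open>0 \<le> \<rho>\<close> w(1) by (simp add: field_simps)
  have "\<bar>(\<Sum>\<^sub>\<infinity>D\<in>P. m D) - (\<Sum>\<^sub>\<infinity>D\<in>Q. m D)\<bar> \<le> \<eta>" if P: "packing K P" "matched e P Q" for P
  proof -
    obtain R where "matching e P Q R"
      using P(2) unfolding matched_def by blast
    note R = matchingD[OF this]
    have P_copies: "A \<in> copies K" if "A \<in> P" for A
      using P(1) that by (auto simp: packing_iff)
    have S_sub: "D \<subseteq> cball 0 (\<rho> + 1 + w)" if "D \<in> S" for D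
      using w(2)[OF S_copies[OF that]] that by (simp add: S_def)
    have "\<exists>!A. R A D" if "D \<in> S" for D
    proof (rule R(3))
      show "D \<in> Q"
        using that by (simp add: S_def)
      show "D \<subseteq> cball 0 (1 / e)"
        using S_sub[OF that] e_inv subset_cball[of "\<rho> + 1 + w" "1 / e" 0] by auto
    qed
    then obtain \<phi> where \<phi>: "\<And>D. D \<in> S \<Longrightarrow> R (\<phi> D) D" "\<And>A D. D \<in> S \<Longrightarrow> R A D \<Longrightarrow> A = \<phi> D"
      by metis
    have "inj_on \<phi> S"
    proof
      fix D E assume DE: "D \<in> S" "E \<in> S" "\<phi> D = \<phi> E"
      have "near e D (\<phi> D)" "\<phi> D \<in> P"
        using R(1)[OF \<phi>(1)[OF DE(1)]] near_sym by blast+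
      then have "\<phi> D \<subseteq> cball 0 (\<rho> + 1 + w + e)"
        using near_subset_cball S_sub[OF DE(1)] by blast
      then have "\<phi> D \<subseteq> cball 0 (1 / e)"
        using e_inv \<open>e \<le> 1\<close> by (auto dest!: subsetD)
      then have "\<exists>!B. R (\<phi> D) B"
        by (rule R(2)[OF \<open>\<phi> D \<in> P\<close>])
      moreover have "R (\<phi> D) D" "R (\<phi> D) E"
        using \<phi>(1)[OF DE(1)] \<phi>(1)[OF DE(2)] DE(3) by simp_all
      ultimately show "D = E"
        by (elim ex1E) blast
    qed
    \<comment> \<open>A contributing member of \<open>P\<close> meets the ball, so it lies in the
      window and its partner belongs to \<open>S\<close>; by uniqueness it is the value of \<phi> at
      that partner.\<close>
    have "(\<Sum>\<^sub>\<infinity>D\<in>P. m D) = (\<Sum>\<^sub>\<infinity>D\<in>\<phi> ` S. m D)"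
    proof (rule infsum_cong_neutral)
      fix A assume A: "A \<in> P - \<phi> ` S"
      show "m A = 0"
      proof (rule ccontr)
        assume "m A \<noteq> 0"
        then have meets: "A \<inter> cball 0 \<rho> \<noteq> {}"
          using m0 by blast
        then have "A \<subseteq> cball 0 (\<rho> + w)"
          using w(2) P_copies A by blast
        then have "A \<subseteq> cball 0 (1 / e)"
          using e_inv by (auto dest!: subsetD)
        then obtain B where B: "R A B"
          using R(2)[of A] A by blast
        obtain x where x: "x \<in> A" "norm x \<le> \<rho>"
          using meets by auto
        obtain y where y: "y \<in> B" "dist x y \<le> e"
          using R(1)[OF B] x(1) by (auto simp: near_def)
        have "norm y \<le> \<rho> + 1"
          using x(2) y(2) \<open>e \<le> 1\<close> dist_triangle[of 0 y x] by simp
        then have "B \<in> S"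
          using R(1)[OF B] y(1) by (auto simp: S_def)
        then show False
          using \<phi>(2)[OF _ B] A by blast
      qed
    next
      fix A assume "A \<in> \<phi> ` S - P"
      then show "m A = 0"
        using R(1) \<phi>(1) by blast
    qed simp
    also have "\<dots> = (\<Sum>D\<in>S. m (\<phi> D))"
      using \<open>finite S\<close> sum.reindex[OF \<open>inj_on \<phi> S\<close>, of m] by simp
    finally have P_sum: "(\<Sum>\<^sub>\<infinity>D\<in>P. m D) = (\<Sum>D\<in>S. m (\<phi> D))" .
    have "(\<Sum>\<^sub>\<infinity>D\<in>Q. m D) = (\<Sum>\<^sub>\<infinity>D\<in>S. m D)"
    proof (rule infsum_cong_neutral)
      fix D assume "D \<in> Q - S"
      then have "D \<inter> cball 0 (\<rho> + 1) = {}"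
        by (auto simp: S_def)
      then have "D \<inter> cball 0 \<rho> = {}"
        by auto
      then show "m D = 0"
        by (rule m0)
    qed (use \<open>S \<subseteq> Q\<close> in auto)
    then have "(\<Sum>\<^sub>\<infinity>D\<in>P. m D) - (\<Sum>\<^sub>\<infinity>D\<in>Q. m D) = (\<Sum>D\<in>S. m (\<phi> D) - m D)"
      using \<open>finite S\<close> by (simp add: P_sum sum_subtractf)
    also have "\<bar>\<dots>\<bar> \<le> (\<Sum>D\<in>S. \<bar>m (\<phi> D) - m D\<bar>)"
      by (rule sum_abs)
    also have "\<dots> \<le> (\<Sum>D\<in>S. h)"
    proof (rule sum_mono)
      fix D assume "D \<in> S"
      then show "\<bar>m (\<phi> D) - m D\<bar> \<le> h"
        using c(2) R(1)[OF \<phi>(1)] near_mono[OF _ e_c] P_copies by blast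
    qed
    also have "\<dots> \<le> \<eta>"
      using assms(4) by (simp add: h_def field_simps)
    finally show ?thesis .
  qed
  then show ?thesis
    using \<open>0 < e\<close> unfolding m_def by blast
qed

lemma uniform_density_limit:
  fixes K :: "'a::euclidean_space set"
  assumes "compact K" "interior K \<noteq> {}" "packing K P" "packing K Q" "is_limit_of Q P"
    and "uniform_limit UNIV (ball_density P) (\<lambda>p. \<delta>) at_top"
  shows "uniform_limit UNIV (ball_density Q) (\<lambda>p. \<delta>) at_top"
proof (rule uniform_limitI)
  fix e :: real assume "0 < e"
  have "\<forall>\<^sub>F r in at_top. \<forall>p\<in>UNIV. dist (ball_density P r p) \<delta> < e/2"
    using \<open>0 < e\<close> by (intro uniform_limitD[OF assms(6)]) auto
  then show "\<forall>\<^sub>F r in at_top. \<forall>p\<in>UNIV. dist (ball_density Q r p) \<delta> < e"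
    using eventually_gt_at_top[of 0]
  proof eventually_elim
    case (elim r)
    show ?case
    proof
      fix p :: 'a
      define V where "V = measure lebesgue (cball p r)"
      have V: "0 < V"
        unfolding V_def using elim(2) by (simp add: content_cball_pos)
      then have "0 < e/2 * V"
        using \<open>0 < e\<close> by simp
      from mass_continuous[OF assms(1,2,4) this, of p r] obtain d where d: "0 < d"
        "\<And>P'. packing K P' \<Longrightarrow> matched d P' Q \<Longrightarrow>
          \<bar>(\<Sum>\<^sub>\<infinity>D\<in>P'. measure lebesgue (cball p r \<inter> D)) - (\<Sum>\<^sub>\<infinity>D\<in>Q. measure lebesgue (cball p r \<inter> D))\<bar>
            \<le> e/2 * V"
        by blast
      obtain t where "matched d (translate t P) Q"
        using assms(5) d(1) is_limit_of_iff[OF assms(1,4,3)] by blast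
      then have "\<bar>(\<Sum>\<^sub>\<infinity>D\<in>translate t P. measure lebesgue (cball p r \<inter> D)) -
          (\<Sum>\<^sub>\<infinity>D\<in>Q. measure lebesgue (cball p r \<inter> D))\<bar> \<le> e/2 * V"
        by (intro d(2) packing_translate[OF assms(3)])
      then have "\<bar>ball_density (translate t P) r p - ball_density Q r p\<bar> \<le> e/2"
        unfolding ball_density_def V_def[symmetric] diff_divide_distrib[symmetric]
        using V by (simp add: abs_divide divide_le_eq)
      \<comment> \<open>The shift \<open>t\<close> depends on \<open>p\<close> and \<open>r\<close>
        through \<open>d\<close>, so the centre \<open>p - t\<close> is out of control; uniformity
        in the centre supplies the bound.\<close>
      moreover have "dist (ball_density P r (p - t)) \<delta> < e/2"
        using elim(1) by blast
      ultimately show "dist (ball_density Q r p) \<delta> < e"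
        unfolding ball_density_translate dist_real_def by linarith
    qed
  qed
qed


lemma uniformly_dense_limit:
  assumes "compact K" "interior K \<noteq> {}" "packing K Q" "is_limit_of Q P" "uniformly_dense K P"
  shows "uniformly_dense K Q"
proof -
  have P: "packing K P" "has_density P (packing_density K)" "uniform_density P"
    using assms(5) by (auto simp: uniformly_dense_def dense_packing_def)
  obtain \<delta> where \<delta>: "uniform_limit UNIV (ball_density P) (\<lambda>p. \<delta>) at_top"
    using P(3) by (auto simp: uniform_density_def)
  \<comment> \<open>\<open>uniform_density\<close> provides only some limit value; uniqueness of
    limits at one centre identifies it with the packing density.\<close>
  have "((\<lambda>r. ball_density P r 0) \<longlongrightarrow> \<delta>) at_top"
    using tendsto_uniform_limitI[OF \<delta>, of 0] by simp
  moreover have "((\<lambda>r. ball_density P r 0) \<longlongrightarrow> packing_density K) at_top"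
    using P(2) by (simp add: has_density_def)
  ultimately have "\<delta> = packing_density K"
    by (intro tendsto_unique[OF trivial_limit_at_top_linorder])
  then have "uniform_limit UNIV (ball_density Q) (\<lambda>p. packing_density K) at_top"
    using uniform_density_limit[OF assms(1,2) P(1) assms(3,4) \<delta>] by simp
  moreover from this have "has_density Q (packing_density K)"
    unfolding has_density_def by (auto dest: tendsto_uniform_limitI)
  ultimately show ?thesis
    using assms(3) by (auto simp: uniformly_dense_def dense_packing_def uniform_density_def)
qed

section \<open>The empty body and the conclusion\<close>

text \<open>The only packings here are the empty collection and the one whose sole member is the
  empty set. Translations fix both, and they are never matched, since the empty set lies in every
  window and would need a partner.\<close>

lemma packing_empty_uniformly_recurrent:
  assumes "packing {} P"
  shows "uniformly_recurrent {} P"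
proof -
  have empty: "D = {}" if "packing {} B" "D \<in> B" for B and D :: "'a set"
    using that by (auto simp: packing_def)
  have "B = P" if B: "packing {} B" "is_limit_of B P" for B :: "'a set set"
  proof -
    obtain t where t: "matched 1 (translate t P) B"
      using is_limit_of_iff[OF compact_empty B(1) assms] B(2) zero_less_one by blast
    have sub: "A \<subseteq> C" if "packing {} A" "packing {} C" "matched 1 A C" for A C :: "'a set set"
    proof
      fix D assume D: "D \<in> A"
      obtain R where "matching 1 A C R"
        using \<open>matched 1 A C\<close> unfolding matched_def by blast
      note R = matchingD[OF this]
      have "D = {}"
        using empty[OF \<open>packing {} A\<close> D] .
      then obtain E where "R D E"
        using R(2)[OF D] by blast
      then have "E \<in> C"
        using R(1) by blast
      then show "D \<in> C"
        using empty[OF \<open>packing {} C\<close>] \<open>D = {}\<close> by blast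
    qed
    have "translate t P = P"
      using empty[OF assms] by (force simp: translate_def)
    then show ?thesis
      using sub[OF assms B(1)] sub[OF B(1) assms] t matched_sym[OF t] by simp
  qed
  then show ?thesis
    unfolding uniformly_recurrent_def using assms is_limit_of_refl[OF compact_empty] by blast
qed

theorem theorem2:
  fixes K :: "'a::euclidean_space set" and P :: "'a set set"
  assumes "body K" and "packing K P"
  shows "\<exists>Q. uniformly_recurrent K Q \<and> is_limit_of Q P \<and>
             (uniformly_dense K P \<longrightarrow> uniformly_dense K Q)"
proof (cases "K = {}")
  case True
  \<comment> \<open>\<open>P\<close> itself serves as \<open>Q\<close>, so the density claim is
    immediate.\<close>
  then show ?thesis
    using packing_empty_uniformly_recurrent is_limit_of_refl[OF compact_empty] assms(2) by blast
next
  case False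
  have "compact K" "K = closure (interior K)"
    using assms(1) by (auto simp: body_def domain_set_def)
  moreover have "interior K \<noteq> {}"
    using False calculation(2) by auto
  ultimately show ?thesis
    using uniformly_recurrent_limit_exists[OF _ _ assms(2)] uniformly_dense_limit
    unfolding uniformly_recurrent_def by blast
qed

end
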